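(* Let $t$ be an odd positive integer. For any nonnegative integer $n$, $$\sum_{\substack{\lambda \in DD,\ |\lambda|=2tn\\ \#\mathcal{H}_t(\lambda)=2n}}\delta_\lambda \prod_{h \in \mathcal{H}_t(\lambda)} \frac{1}{h\,\varepsilon_h}=\frac{(-1)^n}{n!\, t^n\, 2^n}.$$
   Context: A partition $\lambda=(\lambda_1\ge\dots\ge\lambda_\ell>0)$ has weight $|\lambda|=\sum\lambda_i$; set $\lambda_i=0$ for $i>\ell$; the empty partition is allowed. Its boxes are the pairs $(i,j)$ (row $i$, column $j$) with $1\le i\le\ell$, $1\le j\le\lambda_i$. Ferrers diagrams are drawn in French convention (rows stacked upwards), so a box $(i,j)$ is strictly above the (principal) diagonal iff $i>j$. $\lambda^*$ is the conjugate partition. The hook length of $(i,j)$ is $\lambda_i-j+\lambda^*_j-i+1$. The Durfee length is $D(\lambda)=\#\{i:\lambda_i\ge i\}$, and $\delta_\lambda=(-1)^{D(\lambda)}$. $DD$ is the set of doubled distinct partitions, i.e. partitions $\lambda$ with $\lambda_i=\lambda_i^*+1$ for all $1\le i\le D(\lambda)$ (the empty partition included). $\mathcal H_t(\lambda)$ is the multiset of hook lengths of $\lambda$ that are multiples of $t$; products over it are over all boxes of $\lambda$ whose hook length $h$ is a multiple of $t$, and $\varepsilon_h=-1$ if that box is strictly above the diagonal, $\varepsilon_h=1$ otherwise. *)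

theory Defs
  imports Complex_Main "HOL-Library.Multiset"
begin

definition is_partition :: "nat list \<Rightarrow> bool" where
  "is_partition la \<longleftrightarrow> sorted_wrt (\<ge>) la \<and> (\<forall>x\<in>set la. 0 < x)"

(* Rows and columns are numbered from 1, so row i is the list entry i - 1. *)
definition part :: "nat list \<Rightarrow> nat \<Rightarrow> nat" where
  "part la i = (if 1 \<le> i \<and> i \<le> length la then la ! (i - 1) else 0)"

definition weight :: "nat list \<Rightarrow> nat" where
  "weight la = sum_list la"

definition boxes :: "nat list \<Rightarrow> (nat \<times> nat) set" where
  "boxes la = {(i, j). 1 \<le> i \<and> i \<le> length la \<and> 1 \<le> j \<and> j \<le> part la i}"

(* Entry j is the length of column j of the diagram. *)
definition conj_partition :: "nat list \<Rightarrow> nat list" where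
  "conj_partition la =
     map (\<lambda>j. card {i. 1 \<le> i \<and> i \<le> length la \<and> j \<le> part la i}) [1..<Suc (part la 1)]"

(* Both truncated differences are exact for boxes (i, j) of la. *)
definition hook_length :: "nat list \<Rightarrow> nat \<times> nat \<Rightarrow> nat" where
  "hook_length la = (\<lambda>(i, j). (part la i - j) + (part (conj_partition la) j - i) + 1)"

definition durfee :: "nat list \<Rightarrow> nat" where
  "durfee la = card {i. 1 \<le> i \<and> i \<le> part la i}"

definition delta :: "nat list \<Rightarrow> int" where
  "delta la = (-1) ^ durfee la"

definition DD :: "nat list set" where
  "DD = {la. is_partition la \<and>
             (\<forall>i. 1 \<le> i \<and> i \<le> durfee la \<longrightarrow> part la i = part (conj_partition la) i + 1)}"

definition hook_boxes :: "nat \<Rightarrow> nat list \<Rightarrow> (nat \<times> nat) set" where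
  "hook_boxes t la = {b \<in> boxes la. t dvd hook_length la b}"

definition hook_multiset :: "nat \<Rightarrow> nat list \<Rightarrow> nat multiset" where
  "hook_multiset t la = image_mset (hook_length la) (mset_set (hook_boxes t la))"

(* In French convention a box (i, j) lies strictly above the diagonal iff i > j.  The sign
   depends on the box and not only on its hook length, so products run over boxes. *)
definition hook_sign :: "nat \<times> nat \<Rightarrow> int" where
  "hook_sign = (\<lambda>(i, j). if i > j then -1 else 1)"

lemma finite_boxes: "finite (boxes la)"
proof (rule finite_subset)
  have "part la i \<le> sum_list la" for i
    by (auto simp: part_def intro!: member_le_sum_list)
  then show "boxes la \<subseteq> {..length la} \<times> {..sum_list la}"
    by (auto simp: boxes_def intro: order_trans)
qed simp

lemma finite_partitions_of_weight: "finite {la. is_partition la \<and> weight la = m}"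
proof (rule finite_subset)
  have "length la \<le> sum_list la" if "\<forall>x\<in>set la. 0 < x" for la :: "nat list"
    using that by (induction la) auto
  then show "{la. is_partition la \<and> weight la = m} \<subseteq> {la. set la \<subseteq> {..m} \<and> length la \<le> m}"
    by (auto simp: is_partition_def weight_def intro: member_le_sum_list)
qed (simp add: finite_lists_length_le)

end

theory Submission
  imports Defs "HOL-Computational_Algebra.Polynomial"
begin

text \<open>A doubled distinct partition is determined by the set \<open>S\<close> of its positive Frobenius arms, and its
  summand is a product over the elements and the pairs of elements of \<open>S\<close> whose sum or difference is
  divisible by \<open>t\<close>. Write \<open>W n\<close> for the sum in question. Adding a pair of symmetric \<open>t\<close>-ribbons changes
  \<open>S\<close> by a move, and the summands satisfy two identities: weighted by the ratios of the square roots
  of the summands, the downward moves from a given \<open>S\<close> sum to \<open>n\<close>, and the upward moves sum to a constant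
  \<open>t / 2\<close>, namely \<open>1\<close> for each pair of opposite nonzero residue classes and \<open>1 / 2\<close> for the class of
  \<open>0\<close>. Both are residue computations for explicit rational functions. Exchanging the order of
  summation over moves yields \<open>n W(n) = - W(n - 1) / (2 t)\<close>.\<close>


section \<open>Partial fractions\<close>

text \<open>Square roots enter because a move \<open>m\<close> with unchanged part C multiplies the
  summand by - e k^2 / (t^2 (q + 1)^2), where k is the product of \<open>kap m c\<close> over c in
  C, q is \<open>quo m\<close>, and e is 1/2 for \<open>m = 0\<close> and 1 otherwise. Weighting the
  larger set by (q + 1) / k therefore gives the same number as weighting the smaller one by - e k /
  (t^2 (q + 1)), and - (1 / t^2) (t / 2) is the constant of the recursion. The residue computations
  separate the classes modulo \<open>t\<close> up to sign. As \<open>t\<close> is odd, 0 is the only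
  class equal to its opposite. In any other class the two residues act as charges: equal charges
  interact through differences, opposite ones through sums, and one rational function handles both.
  Multiples of \<open>t\<close> interact through both at once and need a quadratic change of
  variable, which produces the 1/2. The delicate case is a removable pair \<open>r\<close>,
  \<open>t - r\<close> in S, where two poles collide. Neither cores nor quotients are needed: a move
  raises the sum of S by \<open>t\<close> and half the number of hooks by 1, so the two conditions
  on the partition are preserved together.\<close>

definition root_poly :: "('i \<Rightarrow> real) \<Rightarrow> 'i set \<Rightarrow> real poly" where
  "root_poly q J = (\<Prod>j\<in>J. [:- q j, 1:])"

lemma root_poly_insert:
  assumes "finite J" "a \<notin> J"
  shows "root_poly q (insert a J) = pCons 0 (root_poly q J) - smult (q a) (root_poly q J)"
  using assms by (simp add: root_poly_def)

lemma poly_root_poly: "poly (root_poly q J) z = (\<Prod>j\<in>J. z - q j)"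
  by (simp add: root_poly_def poly_prod)

lemma degree_root_poly: "degree (root_poly q J) = card J"
  by (simp add: root_poly_def degree_prod_sum_eq)

lemma lead_coeff_root_poly: "coeff (root_poly q J) (card J) = 1"
proof -
  have "lead_coeff (root_poly q J) = 1"
    unfolding root_poly_def lead_coeff_prod by simp
  then show ?thesis by (simp add: degree_root_poly)
qed

lemma coeff_root_poly_1:
  assumes "card J = Suc m"
  shows "coeff (root_poly q J) m = - sum q J"
proof -
  have "finite J" using assms by (metis card.infinite nat.distinct(1))
  then show ?thesis using assms
  proof (induction J arbitrary: m)
    case (insert a J)
    then have c: "card J = m" by simp
    have "coeff (pCons 0 (root_poly q J)) m = - sum q J"
    proof (cases m)
      case 0
      then show ?thesis using c insert by simp
    next
      case (Suc k)
      then show ?thesis using c insert.IH by simp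
    qed
    then show ?case
      using insert.hyps c lead_coeff_root_poly[of q J] by (simp add: root_poly_insert)
  qed simp
qed

text \<open>Vieta and Newton for the second elementary symmetric function. The factor
  \<open>pCons 0\<close> raises the index by one, so a singleton \<open>J\<close> is covered as
  well, with 0 on both sides.\<close>

lemma coeff_root_poly_2:
  assumes "card J = Suc m"
  shows "coeff (pCons 0 (root_poly q J)) m = ((sum q J)\<^sup>2 - (\<Sum>j\<in>J. (q j)\<^sup>2)) / 2"
proof -
  have "finite J" using assms by (metis card.infinite nat.distinct(1))
  then show ?thesis using assms
  proof (induction J arbitrary: m)
    case (insert a J)
    then have c: "card J = m" by simp
    show ?case
    proof (cases m)
      case 0
      then show ?thesis using c insert by simp
    next
      case (Suc k)
      have "coeff (pCons 0 (root_poly q (insert a J))) m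
          = coeff (pCons 0 (root_poly q J)) k - q a * coeff (root_poly q J) k"
        using insert.hyps Suc by (simp add: root_poly_insert)
      then show ?thesis
        using insert.hyps insert.IH[of k] coeff_root_poly_1[of J k q] c Suc
        by (simp add: field_simps power2_eq_square)
    qed
  qed simp
qed

text \<open>Lagrange interpolation at the points \<open>p i\<close> reproduces \<open>f\<close>, and
  each basis polynomial \<open>root_poly p (I - {i})\<close> is monic of degree
  \<open>card I - 1\<close>. The left side is the sum of the residues of \<open>f\<close> divided by
  \<open>root_poly p I\<close>.\<close>

lemma lagrange_coeff:
  fixes p :: "'i \<Rightarrow> real"
  assumes "finite I" "inj_on p I" "degree f < card I"
  shows "(\<Sum>i\<in>I. poly f (p i) / (\<Prod>k\<in>I - {i}. p i - p k)) = coeff f (card I - 1)"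
proof -
  define w where "w i = poly f (p i) / (\<Prod>k\<in>I - {i}. p i - p k)" for i
  define g where "g = (\<Sum>i\<in>I. smult (w i) (root_poly p (I - {i})))"
  have deg: "degree g < card I"
  proof -
    have "degree g \<le> card I - 1"
      unfolding g_def using assms
      by (intro degree_sum_le order_trans[OF degree_smult_le]) (auto simp: degree_root_poly)
    then show ?thesis using assms by linarith
  qed
  have val: "poly g (p i) = poly f (p i)" if i: "i \<in> I" for i
  proof -
    have nz: "(\<Prod>k\<in>I - {i}. p i - p k) \<noteq> 0"
      using assms i by (auto simp: inj_on_def)
    have "(\<Prod>j\<in>I - {k}. p i - p j) = 0" if "k \<noteq> i" for k
      by (rule prod_zero) (use assms i that in auto)
    then have "poly g (p i) = (\<Sum>k\<in>I. if k = i then w i * (\<Prod>j\<in>I - {i}. p i - p j) else 0)"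
      unfolding g_def poly_sum by (intro sum.cong) (auto simp: poly_root_poly)
    also have "\<dots> = poly f (p i)"
      using assms i nz by (simp add: w_def)
    finally show ?thesis .
  qed
  have "f = g"
  proof (rule poly_eqI_degree[of "p ` I"])
    show "\<And>x. x \<in> p ` I \<Longrightarrow> poly f x = poly g x" using val by auto
  qed (use assms deg in \<open>simp_all add: card_image\<close>)
  have "coeff (root_poly p (I - {i})) (card I - 1) = 1" if "i \<in> I" for i
    using lead_coeff_root_poly[of p "I - {i}"] that assms by simp
  then have "coeff g (card I - 1) = sum w I"
    unfolding g_def coeff_sum by simp
  then show ?thesis using \<open>f = g\<close> by (simp add: w_def)
qed

text \<open>With P = \<open>root_poly p I\<close> and Q = \<open>root_poly q J\<close>, this and its
  two successors read off the coefficient of 1/z of Q/P at infinity, for Q/P of degree -1, 0 and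
  1.\<close>

lemma residue_sum_0:
  fixes p :: "'i \<Rightarrow> real" and q :: "'j \<Rightarrow> real"
  assumes "finite I" "inj_on p I" "card I = Suc (card J)"
  shows "(\<Sum>i\<in>I. (\<Prod>j\<in>J. p i - q j) / (\<Prod>k\<in>I - {i}. p i - p k)) = 1"
  using lagrange_coeff[OF assms(1,2), of "root_poly q J"] assms(3)
  by (simp add: degree_root_poly poly_root_poly lead_coeff_root_poly)

lemma degree_lessI_coeff: "degree f \<le> n \<Longrightarrow> coeff f n = 0 \<Longrightarrow> 0 < n \<Longrightarrow> degree f < n"
  for f :: "real poly"
  by (metis degree_0 le_less leading_coeff_0_iff)

lemma residue_sum_1:
  fixes p :: "'i \<Rightarrow> real" and q :: "'j \<Rightarrow> real"
  assumes "finite I" "finite J" "inj_on p I" "card I = card J"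
  shows "(\<Sum>i\<in>I. (\<Prod>j\<in>J. p i - q j) / (\<Prod>k\<in>I - {i}. p i - p k)) = sum p I - sum q J"
proof (cases "card J")
  case 0
  then show ?thesis using assms by simp
next
  case (Suc m)
  \<comment> \<open>Subtracting P from Q keeps the values at the roots of P and makes the degree
    small enough for \<open>lagrange_coeff\<close>.\<close>
  define f where "f = root_poly q J - root_poly p I"
  have "degree f < card I"
  proof (rule degree_lessI_coeff)
    show "degree f \<le> card I"
      unfolding f_def using assms by (intro degree_diff_le) (simp_all add: degree_root_poly)
    show "coeff f (card I) = 0"
      using lead_coeff_root_poly[of q J] lead_coeff_root_poly[of p I] assms by (simp add: f_def)
  qed (use Suc assms in simp)
  from lagrange_coeff[OF assms(1,3) this] have
    "(\<Sum>i\<in>I. poly f (p i) / (\<Prod>k\<in>I - {i}. p i - p k)) = sum p I - sum q J"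
    using Suc assms by (simp add: f_def coeff_root_poly_1)
  moreover have "poly f (p i) = (\<Prod>j\<in>J. p i - q j)" if "i \<in> I" for i
    using that assms by (auto simp: f_def poly_root_poly)
  ultimately show ?thesis by simp
qed

lemma residue_sum_2:
  fixes p :: "'i \<Rightarrow> real" and q :: "'j \<Rightarrow> real"
  assumes "finite I" "finite J" "inj_on p I" "card J = Suc (card I)"
  shows "(\<Sum>i\<in>I. (\<Prod>j\<in>J. p i - q j) / (\<Prod>k\<in>I - {i}. p i - p k))
       = ((sum p I - sum q J)\<^sup>2 + (\<Sum>i\<in>I. (p i)\<^sup>2) - (\<Sum>j\<in>J. (q j)\<^sup>2)) / 2"
proof (cases "card I")
  case 0
  then obtain a where "J = {a}" using assms by (auto simp: card_1_singleton_iff)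
  then show ?thesis using assms 0 by simp
next
  case (Suc m)
  \<comment> \<open>Q/P = z + \<alpha> + O(1/z), so \<open>f\<close> below is the remainder of Q
    modulo P.\<close>
  define \<alpha> where "\<alpha> = sum p I - sum q J"
  define f where "f = root_poly q J - pCons 0 (root_poly p I) - smult \<alpha> (root_poly p I)"
  have P: "root_poly p I \<noteq> 0"
    using lead_coeff_root_poly[of p I] by auto
  have c: "coeff f (Suc (card I)) = 0" "coeff f (card I) = 0"
    using lead_coeff_root_poly[of q J] lead_coeff_root_poly[of p I] assms Suc
      coeff_root_poly_1[of J "card I" q] coeff_root_poly_1[of I m p]
    by (simp_all add: f_def \<alpha>_def coeff_eq_0 degree_root_poly)
  have "degree f \<le> Suc (card I)"
    unfolding f_def using assms P
    by (intro degree_diff_le order_trans[OF degree_smult_le]) (auto simp: degree_root_poly degree_pCons_eq)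
  from degree_lessI_coeff[OF this c(1)] have "degree f \<le> card I" by simp
  from degree_lessI_coeff[OF this c(2)] have "degree f < card I" using Suc by simp
  then have "(\<Sum>i\<in>I. poly f (p i) / (\<Prod>k\<in>I - {i}. p i - p k)) = coeff f m"
    using lagrange_coeff[OF assms(1,3), of f] Suc by simp
  also have "coeff f m = ((sum p I - sum q J)\<^sup>2 + (\<Sum>i\<in>I. (p i)\<^sup>2) - (\<Sum>j\<in>J. (q j)\<^sup>2)) / 2"
    using coeff_root_poly_2[of J "Suc m" q] coeff_root_poly_2[of I m p] coeff_root_poly_1[of I m p]
      assms Suc
    by (simp add: f_def \<alpha>_def field_simps power2_eq_square)
  finally have eq: "(\<Sum>i\<in>I. poly f (p i) / (\<Prod>k\<in>I - {i}. p i - p k))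
      = ((sum p I - sum q J)\<^sup>2 + (\<Sum>i\<in>I. (p i)\<^sup>2) - (\<Sum>j\<in>J. (q j)\<^sup>2)) / 2" .
  have "poly f (p i) = (\<Prod>j\<in>J. p i - q j)" if "i \<in> I" for i
  proof -
    have "(\<Prod>j\<in>I. p i - p j) = 0" using that assms by (auto intro: prod_zero)
    then show ?thesis by (simp add: f_def poly_root_poly)
  qed
  with eq show ?thesis by simp
qed

section \<open>Residue identities within one residue class\<close>

lemma prod_remove2:
  fixes f :: "'i \<Rightarrow> 'a::comm_monoid_mult"
  assumes "finite A" "a \<in> A" "b \<in> A" "a \<noteq> b"
  shows "prod f A = f a * (f b * prod f (A - {a, b}))"
proof -
  have "prod f A = f a * prod f (A - {a})" using assms by (simp add: prod.remove)
  also have "prod f (A - {a}) = f b * prod f (A - {a} - {b})" using assms by (subst prod.remove[of _ b]) auto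
  also have "A - {a} - {b} = A - {a, b}" by auto
  finally show ?thesis .
qed

text \<open>Models a class \<open>r\<close> with \<open>0 < r\<close>: the integer t x + r is a
  particle at position x with charge 1, and t x + t - r is one at position x with charge -1.\<close>

locale charged =
  fixes I :: "'i set" and x :: "'i \<Rightarrow> nat" and s :: "'i \<Rightarrow> real"
  assumes fin: "finite I"
    and inj: "\<And>i j. i \<in> I \<Longrightarrow> j \<in> I \<Longrightarrow> x i = x j \<Longrightarrow> s i = s j \<Longrightarrow> i = j"
    and sgn: "\<And>i. i \<in> I \<Longrightarrow> s i = 1 \<or> s i = -1"
begin

text \<open>Residues of the quotient of the product of all z - s_j x_j by z times the product of all
  z - s_j (x_j + 1), of degree -1. The pole s_i (x_i + 1) is the step of particle i to x_i + 1; the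
  pole 0 is the creation of two opposite charges at position 0. If the goal of a step is occupied,
  the residue is 0.\<close>

lemma up_identity:
  "(\<Sum>i\<in>I. 1 / (real (x i) + 1) * (\<Prod>j\<in>I - {i}. if s i = s j
        then (real (x i) + 1 - real (x j)) / (real (x i) - real (x j))
        else (real (x i) + real (x j) + 1) / (real (x i) + real (x j) + 2)))
   + (\<Prod>j\<in>I. real (x j) / (real (x j) + 1)) = 1"
proof -
  \<comment> \<open>\<open>None\<close> indexes the additional pole at 0.\<close>
  define p where "p = case_option 0 (\<lambda>i. s i * (real (x i) + 1))"
  define q where "q i = s i * real (x i)" for i
  have "inj_on p (insert None (Some ` I))"
  proof (rule inj_onI)
    fix a b assume ab: "a \<in> insert None (Some ` I)" "b \<in> insert None (Some ` I)" "p a = p b"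
    have nz: "p (Some i) \<noteq> 0" if "i \<in> I" for i using sgn[OF that] by (auto simp: p_def)
    have "i = j" if "i \<in> I" "j \<in> I" "p (Some i) = p (Some j)" for i j
      using that sgn[of i] sgn[of j] inj[of i j] by (auto simp: p_def)
    moreover have "p None = 0" by (simp add: p_def)
    ultimately show "a = b" using ab nz by force
  qed
  then have "(\<Sum>a\<in>insert None (Some ` I). (\<Prod>j\<in>I. p a - q j) / (\<Prod>k\<in>insert None (Some ` I) - {a}. p a - p k)) = 1"
    using fin by (intro residue_sum_0) (simp_all add: card_insert_if card_image)
  moreover have "(\<Sum>a\<in>insert None (Some ` I). (\<Prod>j\<in>I. p a - q j) / (\<Prod>k\<in>insert None (Some ` I) - {a}. p a - p k))
    = (\<Prod>j\<in>I. - q j) / (\<Prod>k\<in>I. - p (Some k)) +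
      (\<Sum>i\<in>I. (\<Prod>j\<in>I. p (Some i) - q j) / (\<Prod>k\<in>insert None (Some ` I) - {Some i}. p (Some i) - p k))"
    using fin by (subst sum.insert) (auto simp: sum.reindex prod.reindex p_def)
  moreover have "(\<Prod>j\<in>I. - q j) / (\<Prod>k\<in>I. - p (Some k)) = (\<Prod>j\<in>I. real (x j) / (real (x j) + 1))"
    unfolding prod_dividef[symmetric]
  proof (rule prod.cong[OF refl])
    fix j assume "j \<in> I"
    then show "- q j / - p (Some j) = real (x j) / (real (x j) + 1)"
      using sgn[of j] by (auto simp: p_def q_def field_simps)
  qed
  moreover have "(\<Prod>j\<in>I. p (Some i) - q j) / (\<Prod>k\<in>insert None (Some ` I) - {Some i}. p (Some i) - p k)
     = 1 / (real (x i) + 1) * (\<Prod>j\<in>I - {i}. if s i = s j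
        then (real (x i) + 1 - real (x j)) / (real (x i) - real (x j))
        else (real (x i) + real (x j) + 1) / (real (x i) + real (x j) + 2))" if i: "i \<in> I" for i
  proof -
    have *: "insert None (Some ` I) - {Some i} = insert None (Some ` (I - {i}))" by auto
    have "(\<Prod>j\<in>I. p (Some i) - q j) / (\<Prod>k\<in>insert None (Some ` I) - {Some i}. p (Some i) - p k)
      = (p (Some i) - q i) / p (Some i) * (\<Prod>j\<in>I - {i}. (p (Some i) - q j) / (p (Some i) - p (Some j)))"
      unfolding * using fin i by (simp add: prod.remove[of I i] prod.reindex prod_dividef p_def)
    also have "(p (Some i) - q i) / p (Some i) = 1 / (real (x i) + 1)"
      using sgn[OF i] by (auto simp: p_def q_def field_simps)
    also have "(\<Prod>j\<in>I - {i}. (p (Some i) - q j) / (p (Some i) - p (Some j))) = (\<Prod>j\<in>I - {i}. if s i = s j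
        then (real (x i) + 1 - real (x j)) / (real (x i) - real (x j))
        else (real (x i) + real (x j) + 1) / (real (x i) + real (x j) + 2))"
    proof (rule prod.cong[OF refl])
      fix j assume "j \<in> I - {i}"
      then have j: "j \<in> I" "j \<noteq> i" by auto
      then have ne: "s i = s j \<Longrightarrow> real (x i) \<noteq> real (x j)" using inj i by auto
      show "(p (Some i) - q j) / (p (Some i) - p (Some j)) = (if s i = s j
        then (real (x i) + 1 - real (x j)) / (real (x i) - real (x j))
        else (real (x i) + real (x j) + 1) / (real (x i) + real (x j) + 2))"
        using sgn[OF i] sgn[OF j(1)] ne
        by (elim disjE) (simp_all add: p_def q_def divide_simps, simp_all add: algebra_simps)
    qed
    finally show ?thesis .
  qed
  ultimately show ?thesis by simp
qed

text \<open>Now the poles are s_i x_i and the zeros are 0 and s_i (x_i + 1). The degree is 1, so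
  second moments enter and leave the energy of the system, which \<open>hooks_slice\<close>
  recognises as a hook count. The hypothesis keeps the poles distinct: opposite charges at position
  0 would share the pole 0.\<close>

lemma down_identity:
  assumes nc: "\<And>i j. i \<in> I \<Longrightarrow> j \<in> I \<Longrightarrow> x i = 0 \<Longrightarrow> x j = 0 \<Longrightarrow> s i = s j"
  shows "(\<Sum>i\<in>I. real (x i) * (\<Prod>j\<in>I - {i}. if s i = s j
        then (real (x i) - 1 - real (x j)) / (real (x i) - real (x j))
        else (real (x i) + real (x j) + 1) / (real (x i) + real (x j))))
   = (\<Sum>i\<in>I. real (x i)) + (real (card I) - (sum s I)\<^sup>2) / 2"
proof -
  define p where "p i = s i * real (x i)" for i
  define q where "q = case_option 0 (\<lambda>i. s i * (real (x i) + 1))"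
  have inj_p: "inj_on p I"
  proof (rule inj_onI)
    fix i j assume *: "i \<in> I" "j \<in> I" "p i = p j"
    then have "x i = x j" using sgn[of i] sgn[of j] by (auto simp: p_def)
    moreover have "s i = s j"
      using * sgn[of i] sgn[of j] nc[of i j] by (auto simp: p_def)
    ultimately show "i = j" using inj * by blast
  qed
  have "(\<Sum>i\<in>I. (\<Prod>j\<in>insert None (Some ` I). p i - q j) / (\<Prod>k\<in>I - {i}. p i - p k))
      = ((sum p I - sum q (insert None (Some ` I)))\<^sup>2 + (\<Sum>i\<in>I. (p i)\<^sup>2) - (\<Sum>j\<in>insert None (Some ` I). (q j)\<^sup>2)) / 2"
    using fin inj_p by (intro residue_sum_2) (simp_all add: card_insert_if card_image)
  also have "sum q (insert None (Some ` I)) = (\<Sum>i\<in>I. p i + s i)"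
    using fin by (subst sum.insert) (auto simp: q_def p_def sum.reindex algebra_simps)
  also have "(\<Sum>j\<in>insert None (Some ` I). (q j)\<^sup>2) = (\<Sum>i\<in>I. (p i)\<^sup>2 + (2 * real (x i) + 1))"
  proof -
    have "(q (Some i))\<^sup>2 = (p i)\<^sup>2 + (2 * real (x i) + 1)" if "i \<in> I" for i
      using sgn[OF that] by (auto simp: p_def q_def algebra_simps power2_eq_square)
    then show ?thesis using fin by (subst sum.insert) (auto simp: sum.reindex q_def)
  qed
  finally have "(\<Sum>i\<in>I. (\<Prod>j\<in>insert None (Some ` I). p i - q j) / (\<Prod>k\<in>I - {i}. p i - p k))
     = - ((\<Sum>i\<in>I. real (x i)) + (real (card I) - (sum s I)\<^sup>2) / 2)"
    by (simp add: sum.distrib sum_distrib_left[symmetric] sum_distrib_right[symmetric] field_simps)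
  moreover have "(\<Prod>j\<in>insert None (Some ` I). p i - q j) / (\<Prod>k\<in>I - {i}. p i - p k)
     = - (real (x i) * (\<Prod>j\<in>I - {i}. if s i = s j
        then (real (x i) - 1 - real (x j)) / (real (x i) - real (x j))
        else (real (x i) + real (x j) + 1) / (real (x i) + real (x j))))" if i: "i \<in> I" for i
  proof -
    have "(\<Prod>j\<in>insert None (Some ` I). p i - q j) / (\<Prod>k\<in>I - {i}. p i - p k)
      = p i * (p i - q (Some i)) * (\<Prod>j\<in>I - {i}. (p i - q (Some j)) / (p i - p j))"
      using fin i by (simp add: prod.reindex prod.remove[of I i] prod_dividef q_def)
    also have "p i * (p i - q (Some i)) = - real (x i)"
      using sgn[OF i] by (auto simp: p_def q_def algebra_simps)
    also have "(\<Prod>j\<in>I - {i}. (p i - q (Some j)) / (p i - p j)) = (\<Prod>j\<in>I - {i}. if s i = s j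
        then (real (x i) - 1 - real (x j)) / (real (x i) - real (x j))
        else (real (x i) + real (x j) + 1) / (real (x i) + real (x j)))"
    proof (rule prod.cong[OF refl])
      fix j assume "j \<in> I - {i}"
      then have j: "j \<in> I" "j \<noteq> i" by auto
      then have ne: "s i = s j \<Longrightarrow> real (x i) \<noteq> real (x j)"
        "s i \<noteq> s j \<Longrightarrow> real (x i) + real (x j) \<noteq> 0" using inj i nc[of i j] by auto
      show "(p i - q (Some j)) / (p i - p j) = (if s i = s j
        then (real (x i) - 1 - real (x j)) / (real (x i) - real (x j))
        else (real (x i) + real (x j) + 1) / (real (x i) + real (x j)))"
        using sgn[OF i] sgn[OF j(1)] ne
        by (elim disjE) (simp_all add: p_def q_def divide_simps, simp_all add: algebra_simps)
    qed
    finally show ?thesis by simp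
  qed
  ultimately show ?thesis by (simp add: sum_negf)
qed

text \<open>Here the poles of \<open>a\<close> and \<open>b\<close> collide at \<open>0\<close>; the factor \<open>z\<close> of the numerator turns them into a
  single simple pole, whose residue is the extra product.\<close>

lemma down_identity_collision:
  assumes ab: "a \<in> I" "b \<in> I" "x a = 0" "x b = 0" "s a \<noteq> s b"
  shows "(\<Sum>i\<in>I. real (x i) * (\<Prod>j\<in>I - {i}. if s i = s j
        then (real (x i) - 1 - real (x j)) / (real (x i) - real (x j))
        else (real (x i) + real (x j) + 1) / (real (x i) + real (x j))))
     + (\<Prod>j\<in>I - {a, b}. (real (x j) + 1) / real (x j))
   = (\<Sum>i\<in>I. real (x i)) + (real (card I) - (sum s I)\<^sup>2) / 2"
proof -
  define p where "p i = s i * real (x i)" for i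
  define q where "q i = s i * (real (x i) + 1)" for i
  define K where "K i j = (if s i = s j
        then (real (x i) - 1 - real (x j)) / (real (x i) - real (x j))
        else (real (x i) + real (x j) + 1) / (real (x i) + real (x j)))" for i j
  have "a \<noteq> b" using ab by auto
  have pos: "x i \<noteq> 0" if "i \<in> I - {a, b}" for i
  proof
    assume "x i = 0"
    moreover have "s i = s a \<or> s i = s b" using that ab sgn[of a] sgn[of b] sgn[of i] by auto
    ultimately show False using that inj[of i a] inj[of i b] ab by auto
  qed
  have inj_p: "inj_on p (I - {b})"
  proof (rule inj_onI)
    fix i j assume *: "i \<in> I - {b}" "j \<in> I - {b}" "p i = p j"
    have xx: "x i = x j" using * sgn[of i] sgn[of j] by (auto simp: p_def)
    show "i = j"
    proof (cases "x i = 0")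
      case True
      then have "i = a" "j = a" using xx pos[of i] pos[of j] * by auto
      then show ?thesis by simp
    next
      case False
      then have "s i = s j" using * sgn[of i] sgn[of j] xx by (auto simp: p_def)
      then show ?thesis using inj * xx by blast
    qed
  qed
  have card: "card I = Suc (card (I - {b}))"
    using ab fin by (metis card.remove)
  have sp: "sum p (I - {b}) = sum p I" "(\<Sum>i\<in>I - {b}. (p i)\<^sup>2) = (\<Sum>i\<in>I. (p i)\<^sup>2)"
    using ab fin by (auto simp: sum_diff1 p_def)
  have "(\<Sum>i\<in>I - {b}. (\<Prod>j\<in>I. p i - q j) / (\<Prod>k\<in>I - {b} - {i}. p i - p k))
      = ((sum p (I - {b}) - sum q I)\<^sup>2 + (\<Sum>i\<in>I - {b}. (p i)\<^sup>2) - (\<Sum>j\<in>I. (q j)\<^sup>2)) / 2"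
    using fin inj_p card by (intro residue_sum_2) simp_all
  also have "sum q I = (\<Sum>i\<in>I. p i + s i)"
    by (simp add: q_def p_def algebra_simps)
  also have "(\<Sum>j\<in>I. (q j)\<^sup>2) = (\<Sum>i\<in>I. (p i)\<^sup>2 + (2 * real (x i) + 1))"
  proof (rule sum.cong[OF refl])
    fix i assume "i \<in> I"
    then show "(q i)\<^sup>2 = (p i)\<^sup>2 + (2 * real (x i) + 1)"
      using sgn[of i] by (auto simp: p_def q_def algebra_simps power2_eq_square)
  qed
  finally have lhs: "(\<Sum>i\<in>I - {b}. (\<Prod>j\<in>I. p i - q j) / (\<Prod>k\<in>I - {b} - {i}. p i - p k))
     = - ((\<Sum>i\<in>I. real (x i)) + (real (card I) - (sum s I)\<^sup>2) / 2)"
    unfolding sp by (simp add: sum.distrib sum_distrib_left[symmetric] sum_distrib_right[symmetric] field_simps)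
  have ratio: "(p i - q j) / (p i - p j) = K i j"
    if i: "i \<in> I - {a, b}" and j: "j \<in> I - {i}" for i j
  proof -
    have ne: "s i = s j \<Longrightarrow> real (x i) \<noteq> real (x j)" "real (x i) + real (x j) \<noteq> 0"
      using inj i j pos[of i] by auto
    have "s i = 1 \<or> s i = -1" "s j = 1 \<or> s j = -1" using i j sgn by auto
    then show ?thesis using ne
      by (elim disjE) (simp_all add: p_def q_def K_def divide_simps, simp_all add: algebra_simps)
  qed
  have summand: "(\<Prod>j\<in>I. p i - q j) / (\<Prod>k\<in>I - {b} - {i}. p i - p k)
     = - (real (x i) * (\<Prod>j\<in>I - {i}. K i j))" if i: "i \<in> I - {a, b}" for i
  proof -
    have e: "I - {b} - {i} = I - {i, b}" "I - {i} - {b} = I - {i, b}" by auto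
    have nz: "p i \<noteq> 0" using i pos[OF i] sgn[of i] by (auto simp: p_def)
    have "(\<Prod>j\<in>I. p i - q j) / (\<Prod>k\<in>I - {b} - {i}. p i - p k)
       = (p i - q i) * (p i - q b) * (\<Prod>j\<in>I - {i, b}. (p i - q j) / (p i - p j))"
      unfolding e using fin ab i by (subst prod_remove2[of I i b]) (auto simp: prod_dividef)
    \<comment> \<open>Since \<open>p b = 0\<close>, a factor \<open>p i\<close> can be traded for
      the missing denominator \<open>p i - p b\<close>.\<close>
    also have "\<dots> = (p i - q i) * p i * ((p i - q b) / (p i - p b) * (\<Prod>j\<in>I - {i, b}. (p i - q j) / (p i - p j)))"
      using nz ab by (simp add: p_def)
    also have "(p i - q b) / (p i - p b) * (\<Prod>j\<in>I - {i, b}. (p i - q j) / (p i - p j))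
       = (\<Prod>j\<in>I - {i}. (p i - q j) / (p i - p j))"
      using fin ab i by (subst prod.remove[of "I - {i}" b]) (auto simp: e)
    also have "\<dots> = (\<Prod>j\<in>I - {i}. K i j)" using ratio i by (intro prod.cong) auto
    also have "(p i - q i) * p i = - real (x i)"
      using i sgn[of i] by (auto simp: p_def q_def algebra_simps)
    finally show ?thesis by simp
  qed
  have "(\<Sum>i\<in>I - {b}. (\<Prod>j\<in>I. p i - q j) / (\<Prod>k\<in>I - {b} - {i}. p i - p k))
    = (\<Prod>j\<in>I. p a - q j) / (\<Prod>k\<in>I - {b} - {a}. p a - p k)
     + (\<Sum>i\<in>I - {a, b}. (\<Prod>j\<in>I. p i - q j) / (\<Prod>k\<in>I - {b} - {i}. p i - p k))"
    using fin ab \<open>a \<noteq> b\<close> by (subst sum.remove[of "I - {b}" a]) (auto intro!: sum.cong)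
  also have "(\<Prod>j\<in>I. p a - q j) / (\<Prod>k\<in>I - {b} - {a}. p a - p k)
    = (p a - q a) * (p a - q b) * (\<Prod>j\<in>I - {a, b}. (p a - q j) / (p a - p j))"
  proof -
    have e: "I - {b} - {a} = I - {a, b}" by auto
    show ?thesis unfolding e using ab fin \<open>a \<noteq> b\<close>
      by (subst prod_remove2[of I a b]) (auto simp: prod_dividef)
  qed
  also have "(p a - q a) * (p a - q b) = -1" using ab sgn[of a] sgn[of b] by (auto simp: p_def q_def)
  also have "(\<Prod>j\<in>I - {a, b}. (p a - q j) / (p a - p j)) = (\<Prod>j\<in>I - {a, b}. (real (x j) + 1) / real (x j))"
  proof (rule prod.cong[OF refl])
    fix j assume "j \<in> I - {a, b}"
    then show "(p a - q j) / (p a - p j) = (real (x j) + 1) / real (x j)"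
      using sgn[of j] pos[of j] ab by (auto simp: p_def q_def field_simps)
  qed
  also have "(\<Sum>i\<in>I - {a, b}. (\<Prod>j\<in>I. p i - q j) / (\<Prod>k\<in>I - {b} - {i}. p i - p k))
     = - (\<Sum>i\<in>I - {a, b}. real (x i) * (\<Prod>j\<in>I - {i}. K i j))"
    using summand by (simp add: sum_negf[symmetric])
  also have "(\<Sum>i\<in>I - {a, b}. real (x i) * (\<Prod>j\<in>I - {i}. K i j)) = (\<Sum>i\<in>I. real (x i) * (\<Prod>j\<in>I - {i}. K i j))"
    using fin ab by (intro sum.mono_neutral_left) auto
  finally show ?thesis using lhs unfolding K_def by linarith
qed

end

text \<open>For multiples of \<open>t\<close> differences and sums interact at once. With poles x (x
  + 1) and zeros x (x - 1) both merge into one linear factor: pole i minus zero j is (x_i + 1 - x_j)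
  (x_i + x_j). The 2 is the particle's own factor 2 x_i divided by x_i (x_i + 1), and makes class 0
  count half.\<close>

lemma up_identity_zero:
  fixes x :: "'i \<Rightarrow> nat"
  assumes fin: "finite I" and inj: "inj_on x I" and pos: "\<And>i. i \<in> I \<Longrightarrow> 0 < x i"
  shows "(\<Sum>i\<in>I. 2 / (real (x i) + 1) * (\<Prod>j\<in>I - {i}.
        (real (x i) + 1 - real (x j)) / (real (x i) - real (x j)) *
        ((real (x i) + real (x j)) / (real (x i) + real (x j) + 1))))
   + (\<Prod>j\<in>I. (real (x j) - 1) / (real (x j) + 1)) = 1"
proof -
  define p where "p = case_option 0 (\<lambda>i. real (x i) * (real (x i) + 1))"
  define q where "q i = real (x i) * (real (x i) - 1)" for i
  have pp: "p (Some i) - p (Some j) = (real (x i) - real (x j)) * (real (x i) + real (x j) + 1)" for i j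
    by (simp add: p_def algebra_simps)
  have pq: "p (Some i) - q j = (real (x i) + 1 - real (x j)) * (real (x i) + real (x j))" for i j
    by (simp add: p_def q_def algebra_simps)
  have "inj_on p (insert None (Some ` I))"
  proof (rule inj_onI)
    fix a b assume ab: "a \<in> insert None (Some ` I)" "b \<in> insert None (Some ` I)" "p a = p b"
    have nz: "p (Some i) \<noteq> 0" if "i \<in> I" for i using pos[OF that] by (simp add: p_def)
    have "p (Some i) - p (Some j) \<noteq> 0" if "i \<in> I" "j \<in> I" "i \<noteq> j" for i j
      unfolding pp using that inj by (auto simp: inj_on_def)
    moreover have "p None = 0" by (simp add: p_def)
    ultimately show "a = b" using ab nz by force
  qed
  then have "(\<Sum>a\<in>insert None (Some ` I). (\<Prod>j\<in>I. p a - q j) / (\<Prod>k\<in>insert None (Some ` I) - {a}. p a - p k)) = 1"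
    using fin by (intro residue_sum_0) (simp_all add: card_insert_if card_image)
  moreover have "(\<Sum>a\<in>insert None (Some ` I). (\<Prod>j\<in>I. p a - q j) / (\<Prod>k\<in>insert None (Some ` I) - {a}. p a - p k))
    = (\<Prod>j\<in>I. - q j) / (\<Prod>k\<in>I. - p (Some k)) +
      (\<Sum>i\<in>I. (\<Prod>j\<in>I. p (Some i) - q j) / (\<Prod>k\<in>insert None (Some ` I) - {Some i}. p (Some i) - p k))"
    using fin by (subst sum.insert) (auto simp: sum.reindex prod.reindex p_def)
  moreover have "(\<Prod>j\<in>I. - q j) / (\<Prod>k\<in>I. - p (Some k)) = (\<Prod>j\<in>I. (real (x j) - 1) / (real (x j) + 1))"
    unfolding prod_dividef[symmetric] using pos by (intro prod.cong) (auto simp: p_def q_def)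
  moreover have "(\<Prod>j\<in>I. p (Some i) - q j) / (\<Prod>k\<in>insert None (Some ` I) - {Some i}. p (Some i) - p k)
     = 2 / (real (x i) + 1) * (\<Prod>j\<in>I - {i}.
        (real (x i) + 1 - real (x j)) / (real (x i) - real (x j)) *
        ((real (x i) + real (x j)) / (real (x i) + real (x j) + 1)))" if i: "i \<in> I" for i
  proof -
    have *: "insert None (Some ` I) - {Some i} = insert None (Some ` (I - {i}))" by auto
    have "(\<Prod>j\<in>I. p (Some i) - q j) / (\<Prod>k\<in>insert None (Some ` I) - {Some i}. p (Some i) - p k)
      = (p (Some i) - q i) / (p (Some i) - p None) * (\<Prod>j\<in>I - {i}. (p (Some i) - q j) / (p (Some i) - p (Some j)))"
      unfolding * using fin i by (simp add: prod.remove[of I i] prod.reindex prod_dividef)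
    also have "(p (Some i) - q i) / (p (Some i) - p None) = 2 / (real (x i) + 1)"
      using pos[OF i] by (simp add: p_def q_def divide_simps) (simp add: algebra_simps)
    finally show ?thesis by (simp add: pp pq)
  qed
  ultimately show ?thesis by simp
qed

text \<open>The poles are x (x - 1) and the zeros x (x + 1). The degree is 0, so first moments
  suffice, and each particle contributes - 2 x. No charge term appears, in accordance with
  \<open>cnt\<close> being 0 on multiples of \<open>t\<close>.\<close>

lemma down_identity_zero:
  fixes x :: "'i \<Rightarrow> nat"
  assumes fin: "finite I" and inj: "inj_on x I" and pos: "\<And>i. i \<in> I \<Longrightarrow> 0 < x i"
  shows "(\<Sum>i\<in>I. real (x i) * (\<Prod>j\<in>I - {i}.
        (real (x i) - 1 - real (x j)) / (real (x i) - real (x j)) *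
        ((real (x i) + real (x j)) / (real (x i) + real (x j) - 1)))) = (\<Sum>i\<in>I. real (x i))"
proof -
  define p where "p i = real (x i) * (real (x i) - 1)" for i
  define q where "q i = real (x i) * (real (x i) + 1)" for i
  have pp: "p i - p j = (real (x i) - real (x j)) * (real (x i) + real (x j) - 1)" for i j
    by (simp add: p_def algebra_simps)
  have pq: "p i - q j = (real (x i) - 1 - real (x j)) * (real (x i) + real (x j))" for i j
    by (simp add: p_def q_def algebra_simps)
  have "inj_on p I"
  proof (rule inj_onI, rule ccontr)
    fix i j assume ij: "i \<in> I" "j \<in> I" "p i = p j" "i \<noteq> j"
    then have "real (x i) \<noteq> real (x j)" using inj by (auto simp: inj_on_def)
    moreover have "real (x i) + real (x j) - 1 \<noteq> 0" using pos[OF ij(1)] pos[OF ij(2)] by linarith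
    ultimately show False using pp[of i j] ij by simp
  qed
  then have "(\<Sum>i\<in>I. (\<Prod>j\<in>I. p i - q j) / (\<Prod>k\<in>I - {i}. p i - p k)) = sum p I - sum q I"
    using fin by (intro residue_sum_1) simp_all
  also have "\<dots> = - 2 * (\<Sum>i\<in>I. real (x i))"
    unfolding sum_subtractf[symmetric] sum_distrib_left
    by (intro sum.cong) (simp_all add: p_def q_def algebra_simps)
  finally have "(\<Sum>i\<in>I. (\<Prod>j\<in>I. p i - q j) / (\<Prod>k\<in>I - {i}. p i - p k)) = - 2 * (\<Sum>i\<in>I. real (x i))" .
  moreover have "(\<Prod>j\<in>I. p i - q j) / (\<Prod>k\<in>I - {i}. p i - p k) = - 2 * (real (x i) * (\<Prod>j\<in>I - {i}.
        (real (x i) - 1 - real (x j)) / (real (x i) - real (x j)) *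
        ((real (x i) + real (x j)) / (real (x i) + real (x j) - 1))))" if i: "i \<in> I" for i
  proof -
    have "(\<Prod>j\<in>I. p i - q j) / (\<Prod>k\<in>I - {i}. p i - p k)
       = (p i - q i) * (\<Prod>j\<in>I - {i}. (p i - q j) / (p i - p j))"
      using fin i by (simp add: prod.remove[of I i] prod_dividef)
    also have "p i - q i = - 2 * real (x i)" by (simp add: p_def q_def algebra_simps)
    finally show ?thesis by (simp add: pp pq)
  qed
  ultimately have "- 2 * (\<Sum>i\<in>I. real (x i) * (\<Prod>j\<in>I - {i}.
        (real (x i) - 1 - real (x j)) / (real (x i) - real (x j)) *
        ((real (x i) + real (x j)) / (real (x i) + real (x j) - 1)))) = - 2 * (\<Sum>i\<in>I. real (x i))"
    by (simp add: sum_distrib_left)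
  then show ?thesis by simp
qed

section \<open>Sets of positive integers modulo an odd number\<close>

context comm_monoid_set
begin

text \<open>Stated for a commutative monoid since it serves \<open>hooks\<close> additively and
  \<open>total_wt\<close> multiplicatively.\<close>

lemma pairs_insert:
  fixes C :: "'b::linorder set"
  assumes fin: "finite C" and u: "u \<notin> C" and sym: "\<And>v w. h v w = h w v"
  shows "F (\<lambda>a. F (h a) {v \<in> insert u C. v < a}) (insert u C)
       = F (h u) C \<^bold>* F (\<lambda>a. F (h a) {v \<in> C. v < a}) C"
proof -
  have 1: "F (h a) {v \<in> insert u C. v < a} = (if u < a then h u a else \<^bold>1) \<^bold>* F (h a) {v \<in> C. v < a}" for a
  proof (cases "u < a")
    case True
    then have "{v \<in> insert u C. v < a} = insert u {v \<in> C. v < a}" by auto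
    then show ?thesis using True fin u sym by simp
  next
    case False
    then have "{v \<in> insert u C. v < a} = {v \<in> C. v < a}" by auto
    then show ?thesis using False by simp
  qed
  have "F (\<lambda>a. F (h a) {v \<in> insert u C. v < a}) (insert u C)
      = F (h u) {v \<in> C. v < u} \<^bold>* (F (\<lambda>a. if u < a then h u a else \<^bold>1) C \<^bold>* F (\<lambda>a. F (h a) {v \<in> C. v < a}) C)"
    unfolding 1 using fin u by (simp add: distrib left_commute)
  also have "F (\<lambda>a. if u < a then h u a else \<^bold>1) C = F (h u) {v \<in> C. u < v}"
    using fin by (simp add: inter_filter)
  also have "F (h u) {v \<in> C. v < u} \<^bold>* (F (h u) {v \<in> C. u < v} \<^bold>* F (\<lambda>a. F (h a) {v \<in> C. v < a}) C)
     = F (h u) ({v \<in> C. v < u} \<union> {v \<in> C. u < v}) \<^bold>* F (\<lambda>a. F (h a) {v \<in> C. v < a}) C"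
    using fin by (subst union_disjoint) (auto simp: assoc)
  also have "{v \<in> C. v < u} \<union> {v \<in> C. u < v} = C"
  proof -
    have "v < u \<or> u < v" if "v \<in> C" for v
      using that u by (cases v u rule: linorder_cases) auto
    then show ?thesis by auto
  qed
  finally show ?thesis .
qed

end

lemma square_sum_pairs:
  fixes s :: "'i::linorder \<Rightarrow> real"
  assumes "finite A"
  shows "(sum s A)\<^sup>2 = (\<Sum>a\<in>A. (s a)\<^sup>2) + 2 * (\<Sum>a\<in>A. \<Sum>b\<in>{b\<in>A. b < a}. s a * s b)"
  using assms
proof (induction A)
  case (insert u C)
  have "(\<Sum>a\<in>insert u C. \<Sum>b\<in>{b\<in>insert u C. b < a}. s a * s b)
      = (\<Sum>b\<in>C. s u * s b) + (\<Sum>a\<in>C. \<Sum>b\<in>{b\<in>C. b < a}. s a * s b)"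
    by (rule sum.pairs_insert) (use insert in \<open>auto simp: mult.commute\<close>)
  then show ?case using insert
    by (simp add: power2_sum sum_distrib_left mult.assoc)
qed simp

section \<open>Residue classes modulo \<open>t\<close> up to sign\<close>

locale odd_modulus =
  fixes t :: int
  assumes odd_t: "odd t" and t_pos: "0 < t"
begin

text \<open>\<open>nat\<close> yields 0 at negative arguments, so that the creation of a pair,
  encoded by some \<open>m < 0\<close>, has \<open>quo m + 1 = 1\<close>.\<close>

definition quo :: "int \<Rightarrow> nat" where
  "quo u = nat (u div t)"

text \<open>\<open>(kap u v)\<^sup>2\<close> is the factor by which the interaction of \<open>u\<close> with \<open>v\<close> changes when \<open>u\<close> is replaced by
  \<open>u + t\<close>; for negative \<open>u\<close> it describes the insertion of the pair \<open>-u\<close>, \<open>t + u\<close>.\<close>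

definition kap :: "int \<Rightarrow> int \<Rightarrow> real" where
  "kap u v = (if t dvd u - v then of_int (u + t - v) / of_int (u - v) else 1)
           * (if t dvd u + v then of_int (u + v) / of_int (u + v + t) else 1)"

definition cnt :: "int \<Rightarrow> int \<Rightarrow> int" where
  "cnt u v = of_bool (t dvd u + v) - of_bool (t dvd u - v)"

text \<open>Half the number of hook lengths divisible by \<open>t\<close>, as
  \<open>card_hook_pairs\<close> shows. A pair with divisible sum adds to the multiples counted by
  \<open>quo\<close>, a pair with divisible difference takes away from them.\<close>

definition hooks :: "int set \<Rightarrow> int" where
  "hooks S = (\<Sum>u\<in>S. int (quo u)) + (\<Sum>u\<in>S. \<Sum>v\<in>{v\<in>S. v < u}. cnt u v)"

definition half :: int where
  "half = (t - 1) div 2"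

text \<open>The common representative in \<open>{0..half}\<close> of the residues of
  \<open>u\<close> and \<open>- u\<close>.\<close>

definition cls :: "int \<Rightarrow> int" where
  "cls u = (if u mod t \<le> half then u mod t else t - u mod t)"

lemma t_half: "t = 2 * half + 1" and half_nonneg: "0 \<le> half"
  using odd_t t_pos by (auto simp: half_def elim!: oddE)

lemma cls_range: "cls u \<in> {0..half}"
  using t_half pos_mod_bound[OF t_pos, of u] pos_mod_sign[OF t_pos, of u] by (auto simp: cls_def)

lemma quo_eqI: "u = t * int k + r \<Longrightarrow> 0 \<le> r \<Longrightarrow> r < t \<Longrightarrow> quo u = k"
  using t_pos by (simp add: quo_def)

lemma quo_decomp: "0 \<le> u \<Longrightarrow> u = t * int (quo u) + u mod t"
  using t_pos by (simp add: quo_def pos_imp_zdiv_nonneg_iff)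

lemma dvd_diff_iff_cls:
  assumes "0 \<le> r" "r \<le> half"
  shows "cls u = r \<longleftrightarrow> t dvd u - r \<or> t dvd u + r"
proof -
  have 1: "t dvd u - r \<longleftrightarrow> u mod t = r"
  proof -
    have "r mod t = r" using assms t_half half_nonneg by (intro mod_pos_pos_trivial) auto
    then show ?thesis using mod_eq_dvd_iff[of u t r] by simp
  qed
  have 2: "t dvd u + r \<longleftrightarrow> u mod t = (- r) mod t"
    using mod_eq_dvd_iff[of u t "- r"] by simp
  have 3: "(- r) mod t = (if r = 0 then 0 else t - r)"
  proof -
    have "r mod t = r" using assms t_half half_nonneg by (intro mod_pos_pos_trivial) auto
    then show ?thesis using t_pos by (simp add: zmod_zminus1_eq_if)
  qed
  show ?thesis
    unfolding 1 2 3 cls_def using assms t_half half_nonneg pos_mod_bound[OF t_pos, of u]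
    by (smt (verit))
qed

lemma cls_eq_if_dvd:
  assumes "t dvd u - v \<or> t dvd u + v"
  shows "cls u = cls v"
proof -
  have "t dvd v - cls v \<or> t dvd v + cls v"
    using dvd_diff_iff_cls[of "cls v" v] cls_range[of v] by auto
  then have "t dvd u - cls v \<or> t dvd u + cls v"
    using assms
  proof (elim disjE)
    assume "t dvd v - cls v" "t dvd u - v"
    from dvd_add[OF this] show ?thesis by simp
  next
    assume "t dvd v - cls v" "t dvd u + v"
    from dvd_diff[OF this(2,1)] show ?thesis by simp
  next
    assume "t dvd v + cls v" "t dvd u - v"
    from dvd_add[OF this] show ?thesis by (simp add: add.commute)
  next
    assume "t dvd v + cls v" "t dvd u + v"
    from dvd_diff[OF this(2,1)] show ?thesis by simp
  qed
  then show ?thesis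
    using dvd_diff_iff_cls[of "cls v" u] cls_range[of v] by auto
qed

definition slice :: "int \<Rightarrow> int set \<Rightarrow> int set" where
  "slice r S = {u \<in> S. cls u = r}"

lemma sum_slices:
  assumes "finite S"
  shows "(\<Sum>r\<in>{0..half}. \<Sum>u\<in>slice r S. f u) = sum f S"
  unfolding slice_def using assms cls_range by (intro sum.group) auto

lemma finite_slice: "finite S \<Longrightarrow> finite (slice r S)"
  by (simp add: slice_def)

lemma kap_eq_1_cls: "cls u \<noteq> cls v \<Longrightarrow> kap u v = 1" and cnt_eq_0_cls: "cls u \<noteq> cls v \<Longrightarrow> cnt u v = 0"
  using cls_eq_if_dvd[of u v] by (auto simp: kap_def cnt_def)

lemma prod_kap_slice:
  assumes "finite S"
  shows "(\<Prod>v\<in>S - A. kap u v) = (\<Prod>v\<in>slice (cls u) S - A. kap u v)"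
  by (rule prod.mono_neutral_right) (use assms in \<open>auto simp: slice_def intro: kap_eq_1_cls\<close>)

lemma hooks_slices:
  assumes "finite S"
  shows "(\<Sum>r\<in>{0..half}. hooks (slice r S)) = hooks S"
proof -
  have "hooks S = (\<Sum>u\<in>S. int (quo u) + (\<Sum>v\<in>{v\<in>S. v < u}. cnt u v))"
    by (simp add: hooks_def sum.distrib)
  also have "\<dots> = (\<Sum>r\<in>{0..half}. \<Sum>u\<in>slice r S. int (quo u) + (\<Sum>v\<in>{v\<in>S. v < u}. cnt u v))"
    using assms by (simp add: sum_slices)
  also have "\<dots> = (\<Sum>r\<in>{0..half}. hooks (slice r S))"
  proof (rule sum.cong[OF refl])
    fix r
    have "(\<Sum>v\<in>{v\<in>S. v < u}. cnt u v) = (\<Sum>v\<in>{v\<in>slice r S. v < u}. cnt u v)" if "u \<in> slice r S" for u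
      by (rule sum.mono_neutral_right) (use assms that in \<open>auto simp: slice_def intro!: cnt_eq_0_cls\<close>)
    then show "(\<Sum>u\<in>slice r S. int (quo u) + (\<Sum>v\<in>{v\<in>S. v < u}. cnt u v)) = hooks (slice r S)"
      by (simp add: hooks_def sum.distrib)
  qed
  finally show ?thesis ..
qed

text \<open>The charge: on a nonzero class it separates the residues \<open>r\<close> and
  \<open>t - r\<close>.\<close>

definition sg :: "int \<Rightarrow> int \<Rightarrow> real" where
  "sg r u = (if t dvd u - r then 1 else -1)"

lemma slice_cases:
  assumes u: "0 \<le> u" "cls u = r"
  obtains "sg r u = 1" "u = t * int (quo u) + r"
  | "sg r u = -1" "u = t * int (quo u) + t - r"
proof -
  have r: "0 \<le> r" "r \<le> half" using cls_range[of u] u by auto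
  have d: "u = t * int (quo u) + u mod t" using quo_decomp u by simp
  consider "u mod t = r" | "u mod t = t - r" "u mod t \<noteq> r"
    using u r by (auto simp: cls_def split: if_splits)
  then show thesis
  proof cases
    case 1
    then have "t dvd u - r" using d by (metis add_diff_cancel_right' dvd_triv_left)
    then show thesis using that(1) d 1 by (simp add: sg_def)
  next
    case 2
    have "\<not> t dvd u - r"
    proof
      assume "t dvd u - r"
      then have "u mod t = r mod t" by (simp add: mod_eq_dvd_iff)
      then show False using 2 r t_half by (simp add: mod_pos_pos_trivial)
    qed
    then show thesis using that(2) d 2 by (simp add: sg_def)
  qed
qed

text \<open>Oddness of \<open>t\<close> enters here: \<open>2 * r\<close> lies strictly between 0
  and \<open>t\<close>, so \<open>r\<close> and \<open>- r\<close> are different residues.\<close>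

lemma dvd_two_r:
  assumes "0 < r" "r \<le> half"
  shows "\<not> t dvd 2 * r"
  using assms t_half zdvd_imp_le[of t "2 * r"] by linarith

text \<open>The 1 for opposite charges is the full period made up by the residues \<open>r\<close>
  and \<open>t - r\<close>.\<close>

lemma slice_dvd:
  assumes r: "0 < r" "r \<le> half" and u: "0 \<le> u" "cls u = r" and v: "0 \<le> v" "cls v = r"
  shows "t dvd u - v \<longleftrightarrow> sg r u = sg r v" "t dvd u + v \<longleftrightarrow> sg r u \<noteq> sg r v"
    "sg r u = sg r v \<Longrightarrow> u - v = t * (int (quo u) - int (quo v))"
    "sg r u \<noteq> sg r v \<Longrightarrow> u + v = t * (int (quo u) + int (quo v) + 1)"
proof -
  have e1: "t dvd t * a + 2 * r \<longleftrightarrow> False" "t dvd t * a - 2 * r \<longleftrightarrow> False" for a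
    using dvd_two_r[OF r] by (simp_all add: dvd_add_right_iff dvd_diff_right_iff)
  have "(t dvd u - v \<longleftrightarrow> sg r u = sg r v) \<and> (t dvd u + v \<longleftrightarrow> sg r u \<noteq> sg r v)
    \<and> (sg r u = sg r v \<longrightarrow> u - v = t * (int (quo u) - int (quo v)))
    \<and> (sg r u \<noteq> sg r v \<longrightarrow> u + v = t * (int (quo u) + int (quo v) + 1))"
  proof (cases rule: slice_cases[OF u]; cases rule: slice_cases[OF v])
    assume a: "sg r u = 1" "u = t * int (quo u) + r" "sg r v = 1" "v = t * int (quo v) + r"
    have "u - v = t * (int (quo u) - int (quo v))" "u + v = t * (int (quo u) + int (quo v)) + 2 * r"
      using a(2,4) by (auto simp: algebra_simps)
    then show ?thesis using a(1,3) e1 by simp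
  next
    assume a: "sg r u = 1" "u = t * int (quo u) + r" "sg r v = -1" "v = t * int (quo v) + t - r"
    have "u - v = t * (int (quo u) - int (quo v) - 1) + 2 * r" "u + v = t * (int (quo u) + int (quo v) + 1)"
      using a(2,4) by (auto simp: algebra_simps)
    then show ?thesis using a(1,3) e1 by simp
  next
    assume a: "sg r u = -1" "u = t * int (quo u) + t - r" "sg r v = 1" "v = t * int (quo v) + r"
    have "u - v = t * (int (quo u) - int (quo v) + 1) - 2 * r" "u + v = t * (int (quo u) + int (quo v) + 1)"
      using a(2,4) by (auto simp: algebra_simps)
    then show ?thesis using a(1,3) e1 by simp
  next
    assume a: "sg r u = -1" "u = t * int (quo u) + t - r" "sg r v = -1" "v = t * int (quo v) + t - r"
    have "u - v = t * (int (quo u) - int (quo v))" "u + v = t * (int (quo u) + int (quo v) + 2) - 2 * r"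
      using a(2,4) by (auto simp: algebra_simps)
    then show ?thesis using a(1,3) e1 by simp
  qed
  then show "t dvd u - v \<longleftrightarrow> sg r u = sg r v" "t dvd u + v \<longleftrightarrow> sg r u \<noteq> sg r v"
    "sg r u = sg r v \<Longrightarrow> u - v = t * (int (quo u) - int (quo v))"
    "sg r u \<noteq> sg r v \<Longrightarrow> u + v = t * (int (quo u) + int (quo v) + 1)" by auto
qed

lemma kap_slice:
  assumes r: "0 < r" "r \<le> half" and u: "0 \<le> u" "cls u = r" and v: "0 \<le> v" "cls v = r"
  shows "kap u v = (if sg r u = sg r v
        then (real (quo u) + 1 - real (quo v)) / (real (quo u) - real (quo v))
        else (real (quo u) + real (quo v) + 1) / (real (quo u) + real (quo v) + 2))"
proof (cases "sg r u = sg r v")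
  case True
  note d = slice_dvd[OF assms]
  have 1: "real_of_int (u - v) = of_int t * (real (quo u) - real (quo v))"
    using arg_cong[OF d(3)[OF True], of real_of_int] by simp
  then have "real_of_int (u + t - v) = of_int t * (real (quo u) + 1 - real (quo v))"
    by (simp add: algebra_simps)
  then have "of_int (u + t - v) / of_int (u - v)
      = (of_int t * (real (quo u) + 1 - real (quo v))) / (of_int t * (real (quo u) - real (quo v)))"
    using 1 by (simp only:)
  then show ?thesis using True d t_pos by (simp add: kap_def)
next
  case False
  note d = slice_dvd[OF assms]
  have 1: "real_of_int (u + v) = of_int t * (real (quo u) + real (quo v) + 1)"
    using arg_cong[OF d(4)[OF False], of real_of_int] by simp
  then have "real_of_int (u + v + t) = of_int t * (real (quo u) + real (quo v) + 2)"
    by (simp add: algebra_simps)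
  then have "of_int (u + v) / of_int (u + v + t)
      = (of_int t * (real (quo u) + real (quo v) + 1)) / (of_int t * (real (quo u) + real (quo v) + 2))"
    using 1 by (simp only:)
  then show ?thesis using False d t_pos by (simp add: kap_def)
qed

lemma charged_slice:
  assumes r: "0 < r" "r \<le> half" and S: "finite S" "\<And>u. u \<in> S \<Longrightarrow> 0 < u"
  shows "charged (slice r S) quo (sg r)"
proof
  show "finite (slice r S)" using S finite_slice by blast
  show "sg r u = 1 \<or> sg r u = - 1" for u by (simp add: sg_def)
  fix u v assume uv: "u \<in> slice r S" "v \<in> slice r S" "quo u = quo v" "sg r u = sg r v"
  then have "0 \<le> u" "cls u = r" "0 \<le> v" "cls v = r" using S(2) by (auto simp: slice_def less_imp_le)
  from slice_dvd(3)[OF r this] uv show "u = v" by simp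
qed

text \<open>Within the class \<open>cnt u v\<close> is minus the product of the two charges, so
  \<open>square_sum_pairs\<close> turns the pair sum into the square of the total charge.\<close>

lemma hooks_slice:
  assumes r: "0 < r" "r \<le> half" and S: "finite S" "\<And>u. u \<in> S \<Longrightarrow> 0 < u"
  shows "real_of_int (hooks (slice r S)) = (\<Sum>u\<in>slice r S. real (quo u))
      + (real (card (slice r S)) - (sum (sg r) (slice r S))\<^sup>2) / 2"
proof -
  have c: "real_of_int (cnt u v) = - (sg r u * sg r v)" if "u \<in> slice r S" "v \<in> slice r S" for u v
  proof -
    have "0 \<le> u" "cls u = r" "0 \<le> v" "cls v = r" using that S(2) by (auto simp: slice_def less_imp_le)
    from slice_dvd(1,2)[OF r this] show ?thesis unfolding cnt_def by (auto simp: sg_def)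
  qed
  have "real_of_int (hooks (slice r S)) = (\<Sum>u\<in>slice r S. real (quo u))
      - (\<Sum>u\<in>slice r S. \<Sum>v\<in>{v\<in>slice r S. v < u}. sg r u * sg r v)"
    unfolding hooks_def by (simp add: c sum_negf)
  moreover have "(\<Sum>u\<in>slice r S. (sg r u)\<^sup>2) = real (card (slice r S))"
    by (simp add: sg_def if_distrib[of "\<lambda>x. x\<^sup>2"] cong: if_cong)
  ultimately show ?thesis
    using square_sum_pairs[OF finite_slice[OF S(1)], of "sg r" r] by (simp add: field_simps)
qed

lemma zero_slice:
  assumes S: "finite S" "\<And>u. u \<in> S \<Longrightarrow> 0 < u" and u: "u \<in> slice 0 S"
  shows "u = t * int (quo u)" "0 < quo u" "t dvd u"
proof -
  have "t dvd u" using u dvd_diff_iff_cls[of 0 u] half_nonneg by (auto simp: slice_def)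
  then show "t dvd u" "u = t * int (quo u)" using quo_decomp[of u] S(2)[of u] u by (auto simp: slice_def)
  then show "0 < quo u" using S(2)[of u] u by (auto simp: slice_def intro!: Nat.gr0I)
qed

lemma cls_uminus: "0 \<le> r \<Longrightarrow> r \<le> half \<Longrightarrow> cls (- r) = r"
  and cls_self: "0 \<le> r \<Longrightarrow> r \<le> half \<Longrightarrow> cls r = r"
  and cls_t_minus: "0 \<le> r \<Longrightarrow> r \<le> half \<Longrightarrow> cls (t - r) = r"
  using dvd_diff_iff_cls[of r "- r"] dvd_diff_iff_cls[of r r] dvd_diff_iff_cls[of r "t - r"] by auto

text \<open>Not an instance of \<open>kap_slice\<close>, because \<open>u - t\<close> is negative
  when \<open>quo u = 0\<close>; in \<open>down_total\<close> the factor \<open>real (quo u)\<close>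
  then kills the term.\<close>

lemma kap_slice_down:
  assumes r: "0 < r" "r \<le> half" and u: "0 \<le> u" "cls u = r" and v: "0 \<le> v" "cls v = r"
  shows "1 / kap (u - t) v = (if sg r u = sg r v
        then (real (quo u) - 1 - real (quo v)) / (real (quo u) - real (quo v))
        else (real (quo u) + real (quo v) + 1) / (real (quo u) + real (quo v)))"
proof -
  have dv: "t dvd u - t - v \<longleftrightarrow> t dvd u - v" "t dvd u - t + v \<longleftrightarrow> t dvd u + v"
    using dvd_diff_left_iff[of t t "u - v"] dvd_diff_left_iff[of t t "u + v"] by (simp_all add: algebra_simps)
  show ?thesis
  proof (cases "sg r u = sg r v")
    case True
    note d = slice_dvd[OF assms]
    have 1: "real_of_int (u - t + t - v) = of_int t * (real (quo u) - real (quo v))"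
      using arg_cong[OF d(3)[OF True], of real_of_int] by simp
    then have "real_of_int (u - t - v) = of_int t * (real (quo u) - 1 - real (quo v))"
      by (simp add: algebra_simps)
    then have "of_int (u - t - v) / of_int (u - t + t - v)
        = (of_int t * (real (quo u) - 1 - real (quo v))) / (of_int t * (real (quo u) - real (quo v)))"
      using 1 by (simp only:)
    then show ?thesis using True d t_pos dv by (simp add: kap_def)
  next
    case False
    note d = slice_dvd[OF assms]
    have 1: "real_of_int (u - t + v + t) = of_int t * (real (quo u) + real (quo v) + 1)"
      using arg_cong[OF d(4)[OF False], of real_of_int] by simp
    then have "real_of_int (u - t + v) = of_int t * (real (quo u) + real (quo v))"
      by (simp add: algebra_simps)
    then have "of_int (u - t + v + t) / of_int (u - t + v)
        = (of_int t * (real (quo u) + real (quo v) + 1)) / (of_int t * (real (quo u) + real (quo v)))"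
      using 1 by (simp only:)
    then show ?thesis using False d t_pos dv by (simp add: kap_def)
  qed
qed

text \<open>The created pair has one particle of each charge at position 0, hence the same value for
  both charges of \<open>v\<close>; each time just one of the two factors of \<open>kap\<close> is
  active.\<close>

lemma kap_create:
  assumes r: "0 < r" "r \<le> half" and v: "0 \<le> v" "cls v = r"
  shows "kap (- r) v = real (quo v) / (real (quo v) + 1)"
proof (cases rule: slice_cases[OF v])
  case 1
  have "t dvd r - v" by (subst 1(2)) simp
  moreover have "\<not> t dvd - r - v"
    using dvd_two_r[OF r] dvd_diff[OF \<open>t dvd r - v\<close>, of "- r - v"] by auto
  moreover have e: "real_of_int (- r + v) = of_int t * real (quo v)"
    using arg_cong[OF 1(2), of real_of_int] by simp
  then have "real_of_int (- r + v + t) = of_int t * (real (quo v) + 1)"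
    by (simp add: algebra_simps)
  then have "real_of_int (- r + v) / real_of_int (- r + v + t) =
      (of_int t * real (quo v)) / (of_int t * (real (quo v) + 1))"
    using e by (simp only:)
  ultimately show ?thesis using t_pos dvd_minus_iff[of t "r - v"] by (simp add: kap_def)
next
  case 2
  have "t dvd r + v" by (subst 2(2)) simp
  moreover have "\<not> t dvd - r + v"
    using dvd_two_r[OF r] dvd_diff[OF \<open>t dvd r + v\<close>, of "- r + v"] by auto
  moreover have e: "real_of_int (- r - v) = - (of_int t * (real (quo v) + 1))"
    using arg_cong[OF 2(2), of real_of_int] by (simp add: algebra_simps)
  then have "real_of_int (- r + t - v) = - (of_int t * real (quo v))"
    by (simp add: algebra_simps)
  then have "real_of_int (- r + t - v) / real_of_int (- r - v) =
      (- (of_int t * real (quo v))) / (- (of_int t * (real (quo v) + 1)))"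
    using e by (simp only:)
  then have "real_of_int (- r + t - v) / real_of_int (- r - v) =
      (of_int t * real (quo v)) / (of_int t * (real (quo v) + 1))"
    by (simp only: minus_divide_divide)
  moreover have "t dvd - r - v" using dvd_minus_iff[of t "r + v"] \<open>t dvd r + v\<close> by simp
  ultimately show ?thesis using t_pos by (simp add: kap_def)
qed

lemma kap_zero_slice:
  assumes u: "u = t * int (quo u)" and v: "v = t * int (quo v)"
  shows "kap u v = (real (quo u) + 1 - real (quo v)) / (real (quo u) - real (quo v)) *
        ((real (quo u) + real (quo v)) / (real (quo u) + real (quo v) + 1))"
    and "1 / kap (u - t) v = (real (quo u) - 1 - real (quo v)) / (real (quo u) - real (quo v)) *
        ((real (quo u) + real (quo v)) / (real (quo u) + real (quo v) - 1))"
proof -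
  obtain a b where ab: "quo u = a" "quo v = b" by blast
  have uv: "u = t * int a" "v = t * int b" using u v ab by auto
  have 1: "real_of_int (u + t - v) = of_int t * (real a + 1 - real b)"
    "real_of_int (u - v) = of_int t * (real a - real b)"
    "real_of_int (u + v) = of_int t * (real a + real b)"
    "real_of_int (u + v + t) = of_int t * (real a + real b + 1)"
    "real_of_int (u - t + t - v) = of_int t * (real a - real b)"
    "real_of_int (u - t - v) = of_int t * (real a - 1 - real b)"
    "real_of_int (u - t + v) = of_int t * (real a + real b - 1)"
    "real_of_int (u - t + v + t) = of_int t * (real a + real b)"
    by (simp_all add: uv algebra_simps)
  have 2: "t dvd u - v" "t dvd u + v" "t dvd u - t - v" "t dvd u - t + v"
    by (simp_all add: uv)
  show "kap u v = (real (quo u) + 1 - real (quo v)) / (real (quo u) - real (quo v)) *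
        ((real (quo u) + real (quo v)) / (real (quo u) + real (quo v) + 1))"
    unfolding kap_def ab 1 using 2 t_pos by simp
  show "1 / kap (u - t) v = (real (quo u) - 1 - real (quo v)) / (real (quo u) - real (quo v)) *
        ((real (quo u) + real (quo v)) / (real (quo u) + real (quo v) - 1))"
    unfolding kap_def ab 1 using 2 t_pos by simp
qed

section \<open>Move sums over all residue classes\<close>

lemma inj_quo_zero_slice:
  assumes S: "finite S" "\<And>u. u \<in> S \<Longrightarrow> 0 < u"
  shows "inj_on quo (slice 0 S)"
  using zero_slice(1)[OF S] by (metis inj_onI)

text \<open>Each of the \<open>half\<close> nonzero classes contributes 1, its creation being
  \<open>m = - r\<close>, and class 0 contributes 1/2; together this is \<open>t / 2\<close>.
  Blocked moves are still included.\<close>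

lemma up_total:
  assumes S: "finite S" "\<And>u. u \<in> S \<Longrightarrow> 0 < u"
  shows "(\<Sum>m\<in>{-half..-1}. \<Prod>c\<in>S. kap m c) + 1 / 2 * (\<Prod>c\<in>S. kap 0 c)
       + (\<Sum>u\<in>S. 1 / (real (quo u) + 1) * (\<Prod>c\<in>S - {u}. kap u c)) = of_int t / 2"
proof -
  define g where "g u = 1 / (real (quo u) + 1) * (\<Prod>c\<in>S - {u}. kap u c)" for u
  have nonzero: "sum g (slice r S) + (\<Prod>c\<in>S. kap (- r) c) = 1" if r: "0 < r" "r \<le> half" for r
  proof -
    interpret charged "slice r S" quo "sg r" by (rule charged_slice[OF r S])
    have nn: "0 \<le> u" "cls u = r" if "u \<in> slice r S" for u
      using that S(2)[of u] by (auto simp: slice_def)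
    have "g u = 1 / (real (quo u) + 1) * (\<Prod>v\<in>slice r S - {u}. if sg r u = sg r v
        then (real (quo u) + 1 - real (quo v)) / (real (quo u) - real (quo v))
        else (real (quo u) + real (quo v) + 1) / (real (quo u) + real (quo v) + 2))"
      if u: "u \<in> slice r S" for u
      unfolding g_def prod_kap_slice[OF S(1)]
      using kap_slice[OF r nn[OF u]] nn nn(2)[OF u] by (auto intro!: prod.cong arg_cong2[where f="(*)"])
    moreover have "(\<Prod>c\<in>S. kap (- r) c) = (\<Prod>v\<in>slice r S. real (quo v) / (real (quo v) + 1))"
      using prod_kap_slice[OF S(1), where A="{}" and u="- r"] cls_uminus[of r] r kap_create[OF r] nn
      by (auto intro!: prod.cong)
    ultimately show ?thesis using up_identity by simp
  qed
  have zero: "sum g (slice 0 S) + 1 / 2 * (\<Prod>c\<in>S. kap 0 c) = 1 / 2"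
  proof -
    have z: "t dvd 0 - v" "t dvd 0 + v" "v = t * int (quo v)" if "v \<in> slice 0 S" for v
      using zero_slice[OF S] that by auto
    have "2 * g u = 2 / (real (quo u) + 1) * (\<Prod>v\<in>slice 0 S - {u}.
        (real (quo u) + 1 - real (quo v)) / (real (quo u) - real (quo v)) *
        ((real (quo u) + real (quo v)) / (real (quo u) + real (quo v) + 1)))"
      if u: "u \<in> slice 0 S" for u
    proof -
      have "cls u = 0" using u by (simp add: slice_def)
      then show ?thesis unfolding g_def prod_kap_slice[OF S(1)]
        using kap_zero_slice(1)[OF z(3)[OF u]] z(3) by (auto intro!: prod.cong)
    qed
    then have "2 * sum g (slice 0 S) = (\<Sum>u\<in>slice 0 S. 2 / (real (quo u) + 1) * (\<Prod>v\<in>slice 0 S - {u}.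
        (real (quo u) + 1 - real (quo v)) / (real (quo u) - real (quo v)) *
        ((real (quo u) + real (quo v)) / (real (quo u) + real (quo v) + 1))))"
      by (simp add: sum_distrib_left)
    moreover have "(\<Prod>c\<in>S. kap 0 c) = (\<Prod>v\<in>slice 0 S. (real (quo v) - 1) / (real (quo v) + 1))"
    proof -
      have "kap 0 v = (real (quo v) - 1) / (real (quo v) + 1)" if v: "v \<in> slice 0 S" for v
      proof -
        have "quo 0 = 0" by (simp add: quo_def)
        moreover have "0 < real (quo v)" using zero_slice[OF S v] by simp
        then have "(0 + 1 - real (quo v)) / (0 - real (quo v)) * ((0 + real (quo v)) / (0 + real (quo v) + 1))
            = (real (quo v) - 1) / (real (quo v) + 1)"
          using minus_divide_divide[of "real (quo v) - 1" "real (quo v)"] by simp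
        ultimately show ?thesis
          using kap_zero_slice(1)[of 0, OF _ z(3)[OF v]] by simp
      qed
      then show ?thesis
        using prod_kap_slice[OF S(1), where A="{}" and u="0"] cls_self[of 0] half_nonneg by simp
    qed
    ultimately show ?thesis
      using up_identity_zero[OF finite_slice[OF S(1)] inj_quo_zero_slice[OF S] zero_slice(2)[OF S]]
      by simp
  qed
  have "sum g S = (\<Sum>r\<in>{0..half}. sum g (slice r S))"
    using S by (simp add: sum_slices)
  also have "{0..half} = insert 0 {1..half}" using half_nonneg by auto
  also have "(\<Sum>r\<in>insert 0 {1..half}. sum g (slice r S)) = sum g (slice 0 S) + (\<Sum>r\<in>{1..half}. 1 - (\<Prod>c\<in>S. kap (- r) c))"
    using nonzero by (auto intro!: sum.cong simp: algebra_simps)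
  also have "(\<Sum>r\<in>{1..half}. 1 - (\<Prod>c\<in>S. kap (- r) c)) = of_int half - (\<Sum>m\<in>{-half..-1}. \<Prod>c\<in>S. kap m c)"
  proof -
    have "(\<Sum>r\<in>{1..half}. \<Prod>c\<in>S. kap (- r) c) = (\<Sum>m\<in>{-half..-1}. \<Prod>c\<in>S. kap m c)"
      by (rule sum.reindex_bij_witness[of _ uminus uminus]) auto
    then show ?thesis using half_nonneg by (simp add: sum_subtractf)
  qed
  finally show ?thesis
    using zero arg_cong[OF t_half, of real_of_int] unfolding g_def by (simp add: field_simps)
qed

text \<open>In each nonzero class, the presence of both \<open>r\<close> and \<open>t - r\<close>
  decides between \<open>down_identity_collision\<close> and \<open>down_identity\<close>; the
  residue at the merged pole is the removal of that pair.\<close>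

lemma down_total:
  assumes S: "finite S" "\<And>u. u \<in> S \<Longrightarrow> 0 < u"
  shows "(\<Sum>u\<in>S. real (quo u) * (\<Prod>c\<in>S - {u}. 1 / kap (u - t) c))
       + (\<Sum>r\<in>{1..half}. if r \<in> S \<and> t - r \<in> S then \<Prod>c\<in>S - {r, t - r}. 1 / kap (- r) c else 0)
       = of_int (hooks S)"
proof -
  define g where "g u = real (quo u) * (\<Prod>c\<in>S - {u}. 1 / kap (u - t) c)" for u
  have cls_t: "cls (u - t) = cls u" for u
    by (simp add: cls_def)
  have nonzero: "sum g (slice r S) + (if r \<in> S \<and> t - r \<in> S then \<Prod>c\<in>S - {r, t - r}. 1 / kap (- r) c else 0)
      = of_int (hooks (slice r S))" if r: "0 < r" "r \<le> half" for r
  proof -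
    interpret charged "slice r S" quo "sg r" by (rule charged_slice[OF r S])
    have nn: "0 \<le> u" "cls u = r" if "u \<in> slice r S" for u
      using that S(2)[of u] by (auto simp: slice_def)
    have g: "g u = real (quo u) * (\<Prod>v\<in>slice r S - {u}. if sg r u = sg r v
        then (real (quo u) - 1 - real (quo v)) / (real (quo u) - real (quo v))
        else (real (quo u) + real (quo v) + 1) / (real (quo u) + real (quo v)))"
      if u: "u \<in> slice r S" for u
    proof -
      have "(\<Prod>c\<in>S - {u}. 1 / kap (u - t) c) = (\<Prod>c\<in>slice r S - {u}. 1 / kap (u - t) c)"
        using prod_kap_slice[OF S(1), where A="{u}" and u="u - t"] cls_t[of u] nn[OF u] by (simp add: prod_dividef)
      then show ?thesis unfolding g_def
        using kap_slice_down[OF r nn[OF u]] nn by (auto intro!: prod.cong)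
    qed
    show ?thesis
    proof (cases "r \<in> S \<and> t - r \<in> S")
      case True
      have "r < t" using r t_half by linarith
      have ab: "r \<in> slice r S" "t - r \<in> slice r S" "quo r = 0" "quo (t - r) = 0"
        using True cls_self[of r] cls_t_minus[of r] r \<open>r < t\<close>
        by (auto simp: slice_def intro!: quo_eqI)
      have sg: "sg r r \<noteq> sg r (t - r)"
      proof -
        have "t - r - r = t - 2 * r" by simp
        then have "\<not> t dvd t - r - r" using dvd_two_r[OF r] dvd_diff_right_iff[of t t "2 * r"] by auto
        then show ?thesis by (simp add: sg_def)
      qed
      have "(\<Prod>c\<in>S - {r, t - r}. 1 / kap (- r) c) = (\<Prod>c\<in>slice r S - {r, t - r}. 1 / kap (- r) c)"
        using prod_kap_slice[OF S(1), where A="{r, t - r}" and u="- r"] cls_uminus[of r] r by (simp add: prod_dividef)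
      also have "\<dots> = (\<Prod>v\<in>slice r S - {r, t - r}. (real (quo v) + 1) / real (quo v))"
        using kap_create[OF r] nn by (auto intro!: prod.cong)
      finally show ?thesis
        using down_identity_collision[OF ab sg] True g hooks_slice[OF r S] by simp
    next
      case False
      \<comment> \<open>Opposite charges at position 0 could only be \<open>r\<close> and
        \<open>t - r\<close>, which are not both in \<open>S\<close> here.\<close>
      have nc: "sg r u = sg r v" if uv: "u \<in> slice r S" "v \<in> slice r S" "quo u = 0" "quo v = 0" for u v
      proof (rule ccontr)
        assume ne: "sg r u \<noteq> sg r v"
        have "r \<in> {u, v} \<and> t - r \<in> {u, v}"
          by (cases rule: slice_cases[OF nn[OF uv(1)]]; cases rule: slice_cases[OF nn[OF uv(2)]])
            (use ne uv(3,4) in auto)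
        moreover have "{u, v} \<subseteq> S" using uv(1,2) by (simp add: slice_def)
        ultimately have "r \<in> S \<and> t - r \<in> S" by (meson subsetD)
        with False show False by (rule notE)
      qed
      have "sum g (slice r S) = (\<Sum>u\<in>slice r S. real (quo u) * (\<Prod>v\<in>slice r S - {u}. if sg r u = sg r v
          then (real (quo u) - 1 - real (quo v)) / (real (quo u) - real (quo v))
          else (real (quo u) + real (quo v) + 1) / (real (quo u) + real (quo v))))"
        by (rule sum.cong[OF refl g])
      also have "\<dots> = (\<Sum>u\<in>slice r S. real (quo u))
          + (real (card (slice r S)) - (sum (sg r) (slice r S))\<^sup>2) / 2"
        by (rule down_identity) (rule nc)
      also have "\<dots> = of_int (hooks (slice r S))"
        by (rule hooks_slice[OF r S, symmetric])
      finally have "sum g (slice r S) = of_int (hooks (slice r S))" .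
      then show ?thesis unfolding if_not_P[OF False] by simp
    qed
  qed
  have zero: "sum g (slice 0 S) = of_int (hooks (slice 0 S))"
  proof -
    have z: "t dvd v" "v = t * int (quo v)" if "v \<in> slice 0 S" for v
      using zero_slice[OF S] that by auto
    have "g u = real (quo u) * (\<Prod>v\<in>slice 0 S - {u}.
        (real (quo u) - 1 - real (quo v)) / (real (quo u) - real (quo v)) *
        ((real (quo u) + real (quo v)) / (real (quo u) + real (quo v) - 1)))"
      if u: "u \<in> slice 0 S" for u
    proof -
      have "cls u = 0" using u by (simp add: slice_def)
      then have "(\<Prod>c\<in>S - {u}. 1 / kap (u - t) c) = (\<Prod>c\<in>slice 0 S - {u}. 1 / kap (u - t) c)"
        using prod_kap_slice[OF S(1), where A="{u}" and u="u - t"] cls_t[of u] by (simp add: prod_dividef)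
      then show ?thesis unfolding g_def
        using kap_zero_slice(2)[OF z(2)[OF u]] z(2) by (auto intro!: prod.cong)
    qed
    then have "sum g (slice 0 S) = (\<Sum>u\<in>slice 0 S. real (quo u))"
      using down_identity_zero[OF finite_slice[OF S(1)] inj_quo_zero_slice[OF S] zero_slice(2)[OF S]]
      by simp
    moreover have "cnt u v = 0" if "u \<in> slice 0 S" "v \<in> slice 0 S" for u v
      using z(1)[OF that(1)] z(1)[OF that(2)] by (simp add: cnt_def)
    ultimately show ?thesis by (simp add: hooks_def)
  qed
  have split: "(\<Sum>r\<in>{0..half}. f r) = f 0 + (\<Sum>r\<in>{1..half}. f r)" for f :: "int \<Rightarrow> real"
  proof -
    have "{0..half} = insert 0 {1..half}" using half_nonneg by auto
    then show ?thesis by simp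
  qed
  have "sum g S = sum g (slice 0 S) + (\<Sum>r\<in>{1..half}. sum g (slice r S))"
    using sum_slices[OF S(1), of g] split[of "\<lambda>r. sum g (slice r S)"] by simp
  moreover have "real_of_int (hooks S) = of_int (hooks (slice 0 S)) + (\<Sum>r\<in>{1..half}. of_int (hooks (slice r S)))"
    using arg_cong[OF hooks_slices[OF S(1)], of real_of_int] split[of "\<lambda>r. of_int (hooks (slice r S))"] by simp
  moreover have "(\<Sum>r\<in>{1..half}. real_of_int (hooks (slice r S)))
    = (\<Sum>r\<in>{1..half}. sum g (slice r S)) +
      (\<Sum>r\<in>{1..half}. if r \<in> S \<and> t - r \<in> S then \<Prod>c\<in>S - {r, t - r}. 1 / kap (- r) c else 0)"
    unfolding sum.distrib[symmetric] using nonzero by (intro sum.cong) auto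
  ultimately show ?thesis using zero unfolding g_def by linarith
qed

subsection \<open>Moves and the recursion\<close>

text \<open>The factors of the summand that involve \<open>u\<close> alone. Two runs of multiples of
  \<open>t\<close> up to \<open>u\<close> give the powers, factorials and alternating sign. If
  \<open>t\<close> divides \<open>u\<close>, the second run is one shorter and the hook length 2 u
  fills the gap up to a factor 2, whence the 1/2. A further sign is the share of \<open>u\<close> in
  \<open>delta\<close>.\<close>

definition wt :: "int \<Rightarrow> real" where
  "wt u = (-1) ^ quo u / (of_int t ^ (2 * quo u) * (fact (quo u))\<^sup>2) * (if t dvd u then 1 / 2 else -1)"

text \<open>For \<open>v < u\<close> in the set, a divisible difference \<open>u - v\<close> is
  missing from both runs of \<open>u\<close>, one of which carries the sign -1. A divisible sum is a
  hook length twice, once on each side of the diagonal.\<close>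

definition wt2 :: "int \<Rightarrow> int \<Rightarrow> real" where
  "wt2 u v = (if t dvd u - v then - (of_int (u - v))\<^sup>2 else 1)
           * (if t dvd u + v then - (1 / (of_int (u + v))\<^sup>2) else 1)"

definition total_wt :: "int set \<Rightarrow> real" where
  "total_wt S = (\<Prod>u\<in>S. wt u) * (\<Prod>u\<in>S. \<Prod>v\<in>{v\<in>S. v < u}. wt2 u v)"

lemma wt2_commute: "wt2 u v = wt2 v u" and cnt_commute: "cnt u v = cnt v u"
  using dvd_diff_commute[of t u v]
  by (simp_all add: wt2_def cnt_def add.commute power2_commute)

lemma total_wt_insert:
  assumes "finite C" "u \<notin> C"
  shows "total_wt (insert u C) = wt u * (\<Prod>c\<in>C. wt2 u c) * total_wt C"
  using prod.pairs_insert[OF assms, of wt2] wt2_commute assms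
  unfolding total_wt_def by simp

lemma hooks_insert:
  assumes "finite C" "u \<notin> C"
  shows "hooks (insert u C) = int (quo u) + (\<Sum>c\<in>C. cnt u c) + hooks C"
  using sum.pairs_insert[OF assms, of cnt] cnt_commute assms
  unfolding hooks_def by simp

text \<open>A move \<open>m > 0\<close> replaces \<open>m\<close> by \<open>m + t\<close>, the move \<open>0\<close> inserts \<open>t\<close>, and a move \<open>m < 0\<close> inserts
  the pair \<open>-m\<close>, \<open>t + m\<close>: these are the ways of adding two \<open>t\<close>-ribbons to a doubled distinct partition.\<close>

definition src :: "int \<Rightarrow> int set" where
  "src m = (if 0 < m then {m} else {})"

definition tgt :: "int \<Rightarrow> int set" where
  "tgt m = (if 0 \<le> m then {m + t} else {- m, t + m})"

lemma src_tgt: "src m \<inter> tgt m = {}" "finite (src m)" "finite (tgt m)"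
  using t_pos by (auto simp: src_def tgt_def)

lemma src_pos: "u \<in> src m \<Longrightarrow> 0 < u" and tgt_pos: "- half \<le> m \<Longrightarrow> u \<in> tgt m \<Longrightarrow> 0 < u"
  using t_pos t_half half_nonneg by (auto simp: src_def tgt_def split: if_splits)

lemma quo_add_t: "0 \<le> m \<Longrightarrow> quo (m + t) = Suc (quo m)"
  using t_pos by (simp add: quo_def pos_imp_zdiv_nonneg_iff nat_add_distrib)

lemma quo_small: "u < t \<Longrightarrow> quo u = 0"
proof -
  assume "u < t"
  then have "u div t \<le> (t - 1) div t" using t_pos by (intro zdiv_mono1) auto
  also have "(t - 1) div t = 0" using t_pos by (intro div_pos_pos_trivial) auto
  finally have "u div t \<le> 0" .
  then show ?thesis by (simp add: quo_def)
qed

lemma dvd_shift: "t dvd m + t - c \<longleftrightarrow> t dvd m - c" "t dvd m + t + c \<longleftrightarrow> t dvd m + c"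
    "t dvd t + m - c \<longleftrightarrow> t dvd m - c" "t dvd t + m + c \<longleftrightarrow> t dvd m + c"
  using dvd_add_right_iff[of t t "m - c"] dvd_add_right_iff[of t t "m + c"] by (simp_all add: algebra_simps)

lemma dvd_neg: "t dvd - m - c \<longleftrightarrow> t dvd m + c" "t dvd - m + c \<longleftrightarrow> t dvd m - c"
  using dvd_minus_iff[of t "m + c"] dvd_minus_iff[of t "m - c"] by simp_all

lemma wt2_shift:
  assumes "0 \<le> m" "0 < c" "c \<noteq> m"
  shows "wt2 (m + t) c = wt2 m c * (kap m c)\<^sup>2"
proof -
  have "real_of_int (m - c) \<noteq> 0" "real_of_int (m + c) \<noteq> 0" using assms by linarith+
  then show ?thesis
    unfolding wt2_def kap_def dvd_shift by (simp add: power_mult_distrib power_divide add_ac)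
qed

lemma wt2_zero: "0 < c \<Longrightarrow> wt2 0 c = 1" and cnt_zero: "cnt 0 c = 0"
  by (simp_all add: wt2_def cnt_def)

text \<open>Modulo \<open>t\<close> the two inserted elements are opposite, so one meets
  \<open>c\<close> through a sum exactly when the other does through a difference.\<close>

lemma wt2_create: "wt2 (- m) c * wt2 (t + m) c = (kap m c)\<^sup>2"
  and cnt_create: "cnt (- m) c + cnt (t + m) c = 0"
  unfolding wt2_def kap_def cnt_def dvd_shift dvd_neg
  by (simp_all add: power_mult_distrib power_divide algebra_simps power2_commute)

lemma cnt_shift: "cnt (m + t) c = cnt m c"
  unfolding cnt_def dvd_shift by simp

lemma wt_shift:
  assumes "0 < m"
  shows "wt (m + t) = wt m * (- 1 / of_int t ^ 2) / (real (quo m) + 1) ^ 2"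
proof -
  have "t dvd m + t \<longleftrightarrow> t dvd m" by simp
  then show ?thesis
    using assms t_pos by (simp add: wt_def quo_add_t field_simps power2_eq_square)
qed

text \<open>Makes the reciprocals in the downward sum genuine, so that they can be cancelled in
  \<open>total_step\<close>.\<close>

lemma kap_neq_0:
  assumes "- half \<le> m" "0 < c" "c \<notin> src m" "c \<notin> tgt m"
  shows "kap m c \<noteq> 0"
proof -
  have "m + t - c \<noteq> 0" "m - c \<noteq> 0" "m + c \<noteq> 0" "m + c + t \<noteq> 0"
    using assms t_half half_nonneg by (auto simp: src_def tgt_def split: if_splits)
  then have "real_of_int (m + t - c) \<noteq> 0" "real_of_int (m - c) \<noteq> 0" "real_of_int (m + c) \<noteq> 0"
    "real_of_int (m + c + t) \<noteq> 0" unfolding of_int_eq_0_iff by blast+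
  then show ?thesis unfolding kap_def by simp
qed

text \<open>\<open>C\<close> is the part untouched by the move. In a shift, \<open>wt\<close>
  supplies \<open>- 1 / of_int t ^ 2\<close> and the squared \<open>quo m + 1\<close>; for a created
  pair, whose elements sum to \<open>t\<close>, their mutual \<open>wt2\<close> supplies
  \<open>- 1 / of_int t ^ 2\<close> and their mutual \<open>cnt\<close> the additional hook.\<close>

lemma
  assumes m: "- half \<le> m" and C: "finite C" "\<And>c. c \<in> C \<Longrightarrow> 0 < c" "C \<inter> src m = {}" "C \<inter> tgt m = {}"
  shows move_hooks: "hooks (C \<union> tgt m) = hooks (C \<union> src m) + 1"
    and move_sum: "\<Sum>(C \<union> tgt m) = \<Sum>(C \<union> src m) + t"
    and move_wt: "total_wt (C \<union> tgt m) = total_wt (C \<union> src m) * (- 1 / of_int t ^ 2)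
          * (if m = 0 then 1 / 2 else 1) * (\<Prod>c\<in>C. kap m c)\<^sup>2 / (real (quo m) + 1)\<^sup>2"
proof -
  have "hooks (C \<union> tgt m) = hooks (C \<union> src m) + 1 \<and> \<Sum>(C \<union> tgt m) = \<Sum>(C \<union> src m) + t \<and>
    total_wt (C \<union> tgt m) = total_wt (C \<union> src m) * (- 1 / of_int t ^ 2)
          * (if m = 0 then 1 / 2 else 1) * (\<Prod>c\<in>C. kap m c)\<^sup>2 / (real (quo m) + 1)\<^sup>2"
  proof (cases "0 \<le> m")
    case True
    then have tm: "tgt m = {m + t}" "m + t \<notin> C" using C by (auto simp: tgt_def)
    have nm: "m \<notin> C" using C True by (cases "m = 0") (auto simp: src_def)
    have p2: "(\<Prod>c\<in>C. wt2 (m + t) c) = (\<Prod>c\<in>C. wt2 m c) * (\<Prod>c\<in>C. kap m c)\<^sup>2"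
      unfolding prod_power_distrib prod.distrib[symmetric]
      using True C(2) nm by (intro prod.cong wt2_shift) auto
    show ?thesis
    proof (cases "m = 0")
      case True
      have "wt t = (- 1 / of_int t ^ 2) * (1 / 2)" and "quo t = 1" and "quo 0 = 0"
        using t_pos quo_add_t[of 0] by (simp_all add: wt_def quo_def)
      then show ?thesis using tm True p2 C(1,2) wt2_zero cnt_zero cnt_shift[of 0]
        by (simp add: src_def hooks_insert total_wt_insert)
    next
      case False
      then have "0 < m" using True by simp
      then show ?thesis using tm nm p2 C(1) quo_add_t[of m] wt_shift[of m]
        by (simp add: src_def hooks_insert total_wt_insert cnt_shift)
    qed
  next
    case False
    have lt: "0 < - m" "- m < t" "0 < t + m" "t + m < t" "- m \<noteq> t + m"
      using False m t_half half_nonneg by auto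
    have tm: "tgt m = {- m, t + m}" "- m \<notin> C" "t + m \<notin> C" "src m = {}"
      using False C by (auto simp: tgt_def src_def)
    have nd: "\<not> t dvd - m" "\<not> t dvd t + m"
      using lt zdvd_imp_le[of t "- m"] zdvd_imp_le[of t "t + m"] by linarith+
    have q: "quo (- m) = 0" "quo (t + m) = 0" "quo m = 0"
      using lt by (simp_all add: quo_small)
    have w: "wt (- m) = -1" "wt (t + m) = -1"
      using nd unfolding wt_def q by simp_all
    have "\<not> t dvd - m - (t + m)"
    proof
      assume "t dvd - m - (t + m)"
      moreover have "- m - (t + m) = 2 * (- m) - t" by simp
      ultimately have "t dvd 2 * (- m) - t" by (simp only:)
      then have "t dvd (2 * (- m) - t) + t" by (rule dvd_add) simp
      then have "t dvd 2 * (- m)" by simp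
      then show False using dvd_two_r[of "- m"] lt(1) m by auto
    qed
    then have pair: "wt2 (- m) (t + m) = - 1 / of_int t ^ 2" "cnt (- m) (t + m) = 1"
      by (simp_all add: wt2_def cnt_def)
    have p: "(\<Prod>c\<in>C. wt2 (- m) c) * (\<Prod>c\<in>C. wt2 (t + m) c) = (\<Prod>c\<in>C. kap m c)\<^sup>2"
      unfolding prod_power_distrib prod.distrib[symmetric] wt2_create ..
    have s: "(\<Sum>c\<in>C. cnt (- m) c) + (\<Sum>c\<in>C. cnt (t + m) c) = 0"
      unfolding sum.distrib[symmetric] cnt_create by simp
    have e: "C \<union> tgt m = insert (- m) (insert (t + m) C)" "C \<union> src m = C" using tm by auto
    have ins: "- m \<notin> insert (t + m) C" "finite (insert (t + m) C)" using tm lt C by auto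
    have "hooks (C \<union> tgt m) = hooks C + 1"
      unfolding e hooks_insert[OF ins(2,1)] hooks_insert[OF C(1) tm(3)]
      using C(1) tm(3) s pair q by simp
    moreover have "total_wt (C \<union> tgt m) = total_wt C * (- 1 / of_int t ^ 2) * (\<Prod>c\<in>C. kap m c)\<^sup>2"
      unfolding e total_wt_insert[OF ins(2,1)] total_wt_insert[OF C(1) tm(3)]
      using C(1) tm(3) pair w p[symmetric] by simp
    moreover have "\<Sum>(C \<union> tgt m) = \<Sum>C + t"
      unfolding e using ins tm C by simp
    ultimately show ?thesis unfolding e q using False by simp
  qed
  then show "hooks (C \<union> tgt m) = hooks (C \<union> src m) + 1" "\<Sum>(C \<union> tgt m) = \<Sum>(C \<union> src m) + t"
    "total_wt (C \<union> tgt m) = total_wt (C \<union> src m) * (- 1 / of_int t ^ 2)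
          * (if m = 0 then 1 / 2 else 1) * (\<Prod>c\<in>C. kap m c)\<^sup>2 / (real (quo m) + 1)\<^sup>2"
    by auto
qed

section \<open>Double counting of moves between states\<close>

definition states :: "nat \<Rightarrow> int set set" where
  "states n = {S. finite S \<and> (\<forall>u\<in>S. 0 < u) \<and> \<Sum>S = t * int n \<and> hooks S = int n}"

lemma states_bound: "S \<in> states n \<Longrightarrow> u \<in> S \<Longrightarrow> u \<le> t * int n"
  unfolding states_def using member_le_sum[of u S "\<lambda>x. x"] by (auto simp: less_imp_le)

lemma finite_states: "finite (states n)"
proof (rule finite_subset)
  show "states n \<subseteq> Pow {0..t * int n}"
    using states_bound by (auto simp: states_def less_imp_le)
qed simp

lemma states_0: "states 0 = {{}}"
proof (intro set_eqI iffI)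
  fix S assume S: "S \<in> states 0"
  have "\<not> 0 < \<Sum>S" using S by (simp add: states_def)
  then have "S = {}" using S sum_pos[of S "\<lambda>u. u"] unfolding states_def by blast
  then show "S \<in> {{}}" by simp
next
  fix S :: "int set" assume "S \<in> {{}}"
  then show "S \<in> states 0" by (simp add: states_def hooks_def)
qed

lemma finite_interval_filter: "finite {m. m \<in> {a..b::int} \<and> P m}"
  by (rule finite_subset[of _ "{a..b}"]) auto

text \<open>Rewrites \<open>down_total\<close> in terms of moves: \<open>u\<close> corresponds to
  \<open>m = u - t\<close> and a removable pair to \<open>m = - r\<close>. The terms without a
  counterpart are steps that cannot be taken, and they vanish.\<close>

lemma down_moves:
  assumes "S \<in> states n"
  shows "(\<Sum>m | m \<in> {-half..t * int n} \<and> tgt m \<subseteq> S \<and> src m \<inter> S = {}.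
      (real (quo m) + 1) / (\<Prod>c\<in>S - tgt m. kap m c)) = real n"
proof -
  have S: "finite S" "\<And>u. u \<in> S \<Longrightarrow> 0 < u" using assms by (auto simp: states_def)
  let ?f = "\<lambda>m. (real (quo m) + 1) / (\<Prod>c\<in>S - tgt m. kap m c)"
  let ?M = "{m \<in> {-half..t * int n}. tgt m \<subseteq> S \<and> src m \<inter> S = {}}"
  have "sum ?f ?M = sum ?f {m\<in>?M. 0 \<le> m} + sum ?f {m\<in>?M. m < 0}"
  proof -
    have fin: "finite ?M" by (rule finite_interval_filter)
    have "sum ?f ({m\<in>?M. 0 \<le> m} \<union> {m\<in>?M. m < 0}) = sum ?f {m\<in>?M. 0 \<le> m} + sum ?f {m\<in>?M. m < 0}"
      by (intro sum.union_disjoint finite_subset[OF _ fin]) auto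
    moreover have "{m\<in>?M. 0 \<le> m} \<union> {m\<in>?M. m < 0} = ?M" by auto
    ultimately show ?thesis by (simp only:)
  qed
  also have "sum ?f {m\<in>?M. 0 \<le> m} = (\<Sum>u | u \<in> S \<and> t \<le> u \<and> u - t \<notin> S. real (quo u) * (\<Prod>c\<in>S - {u}. 1 / kap (u - t) c))"
  proof (rule sum.reindex_bij_witness[of _ "\<lambda>u. u - t" "\<lambda>m. m + t"])
    fix m assume "m \<in> {m\<in>?M. 0 \<le> m}"
    then show "m + t \<in> {u. u \<in> S \<and> t \<le> u \<and> u - t \<notin> S}" "m + t - t = m"
      using S(2)[of m] by (auto simp: tgt_def src_def split: if_splits)
    show "real (quo (m + t)) * (\<Prod>c\<in>S - {m + t}. 1 / kap (m + t - t) c) = ?f m"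
      using \<open>m \<in> {m\<in>?M. 0 \<le> m}\<close> by (simp add: quo_add_t tgt_def prod_dividef)
  next
    fix u assume u: "u \<in> {u. u \<in> S \<and> t \<le> u \<and> u - t \<notin> S}"
    then show "u - t \<in> {m\<in>?M. 0 \<le> m}" "u - t + t = u"
      using states_bound[OF assms, of u] half_nonneg t_pos by (auto simp: tgt_def src_def)
  qed
  also have "\<dots> = (\<Sum>u\<in>S. real (quo u) * (\<Prod>c\<in>S - {u}. 1 / kap (u - t) c))"
  proof (rule sum.mono_neutral_left)
    show "\<forall>u\<in>S - {u. u \<in> S \<and> t \<le> u \<and> u - t \<notin> S}. real (quo u) * (\<Prod>c\<in>S - {u}. 1 / kap (u - t) c) = 0"
    proof
      fix u assume u: "u \<in> S - {u. u \<in> S \<and> t \<le> u \<and> u - t \<notin> S}"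
      show "real (quo u) * (\<Prod>c\<in>S - {u}. 1 / kap (u - t) c) = 0"
      proof (cases "u < t")
        case True
        then show ?thesis by (simp add: quo_small)
      next
        case False
        \<comment> \<open>blocked move: \<open>kap\<close> has denominator \<open>0\<close>, so \<open>kap\<close> and \<open>1 / kap\<close> are both \<open>0\<close> by convention\<close>
        then have "u - t \<in> S - {u}" "1 / kap (u - t) (u - t) = 0" using u t_pos by (auto simp: kap_def)
        then have "(\<Prod>c\<in>S - {u}. 1 / kap (u - t) c) = 0"
          using S(1) by (intro prod_zero) auto
        then show ?thesis by simp
      qed
    qed
  qed (use S in auto)
  also have "sum ?f {m\<in>?M. m < 0} = (\<Sum>r | r \<in> {1..half} \<and> r \<in> S \<and> t - r \<in> S. \<Prod>c\<in>S - {r, t - r}. 1 / kap (- r) c)"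
  proof (rule sum.reindex_bij_witness[of _ uminus uminus])
    fix m assume m: "m \<in> {m\<in>?M. m < 0}"
    then show "- m \<in> {r. r \<in> {1..half} \<and> r \<in> S \<and> t - r \<in> S}" by (auto simp: tgt_def)
    have "quo m = 0" using m t_pos by (auto intro: quo_small)
    then show "(\<Prod>c\<in>S - {- m, t - - m}. 1 / kap (- (- m)) c) = ?f m"
      using m by (simp add: tgt_def prod_dividef)
  next
    fix r assume r: "r \<in> {r. r \<in> {1..half} \<and> r \<in> S \<and> t - r \<in> S}"
    have "0 \<le> t * int n" using t_pos by simp
    then show "- r \<in> {m\<in>?M. m < 0}" using r by (auto simp: tgt_def src_def)
  qed auto
  also have "\<dots> = (\<Sum>r\<in>{1..half}. if r \<in> S \<and> t - r \<in> S then \<Prod>c\<in>S - {r, t - r}. 1 / kap (- r) c else 0)"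
    by (subst sum.inter_filter[symmetric]) auto
  finally show ?thesis
    using down_total[OF S] assms by (simp add: states_def)
qed

text \<open>A blocked move has some \<open>c\<close> of its target in \<open>S\<close>, and then
  \<open>kap m c = 0\<close>. The sum therefore extends to all moves whose source lies in
  \<open>S\<close>, and \<open>up_total\<close> applies.\<close>

lemma up_moves:
  assumes "S \<in> states n"
  shows "(\<Sum>m | m \<in> {-half..t * int (Suc n)} \<and> src m \<subseteq> S \<and> tgt m \<inter> S = {}.
      (if m = 0 then 1 / 2 else 1) * (\<Prod>c\<in>S - src m. kap m c) / (real (quo m) + 1)) = of_int t / 2"
proof -
  have S: "finite S" "\<And>u. u \<in> S \<Longrightarrow> 0 < u" using assms by (auto simp: states_def)
  let ?f = "\<lambda>m. (if m = 0 then 1 / 2 else 1) * (\<Prod>c\<in>S - src m. kap m c) / (real (quo m) + 1)"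
  let ?I = "{-half..t * int (Suc n)}"
  have bound: "u \<in> ?I" if "u \<in> S" for u
    using states_bound[OF assms that] S(2)[OF that] half_nonneg t_pos by (auto simp: algebra_simps)
  have top: "0 \<le> t * int (Suc n)" using t_pos by simp
  have "(\<Sum>m | m \<in> ?I \<and> src m \<subseteq> S \<and> tgt m \<inter> S = {}. ?f m) = (\<Sum>m | m \<in> ?I \<and> src m \<subseteq> S. ?f m)"
  proof (rule sum.mono_neutral_left)
    show "\<forall>m\<in>{m \<in> ?I. src m \<subseteq> S} - {m \<in> ?I. src m \<subseteq> S \<and> tgt m \<inter> S = {}}. ?f m = 0"
    proof
      fix m assume "m \<in> {m \<in> ?I. src m \<subseteq> S} - {m \<in> ?I. src m \<subseteq> S \<and> tgt m \<inter> S = {}}"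
      then obtain c where c: "c \<in> tgt m" "c \<in> S" by auto
      then have "c \<in> S - src m" using src_tgt by auto
      moreover have "kap m c = 0" using c(1) by (auto simp: tgt_def kap_def split: if_splits)
      ultimately have "(\<Prod>c\<in>S - src m. kap m c) = 0" using S(1) by (intro prod_zero) auto
      then show "?f m = 0" by simp
    qed
  qed (rule finite_interval_filter, blast)
  \<comment> \<open>The three blocks are the creations of pairs, the insertion of \<open>t\<close>,
    and the shifts.\<close>
  also have "{m \<in> ?I. src m \<subseteq> S} = {-half..-1} \<union> ({0} \<union> S)"
    using bound S(2) half_nonneg top by (auto simp: src_def split: if_splits)
  also have "sum ?f \<dots> = sum ?f {-half..-1} + (sum ?f {0} + sum ?f S)"
    using S by (subst sum.union_disjoint; (subst sum.union_disjoint)?) (auto dest: S(2))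
  also have "sum ?f {-half..-1} = (\<Sum>m\<in>{-half..-1}. \<Prod>c\<in>S. kap m c)"
    using t_pos by (intro sum.cong) (auto simp: src_def quo_small)
  also have "sum ?f {0} = 1 / 2 * (\<Prod>c\<in>S. kap 0 c)"
    by (simp add: src_def quo_def)
  also have "sum ?f S = (\<Sum>u\<in>S. 1 / (real (quo u) + 1) * (\<Prod>c\<in>S - {u}. kap u c))"
    using S(2) by (intro sum.cong) (auto simp: src_def)
  finally show ?thesis
    using up_total[OF S] by simp
qed

text \<open>Double counting of the moves from \<open>states n\<close> to
  \<open>states (Suc n)\<close>: \<open>g\<close> spreads \<open>Suc n\<close> times the weight of
  the larger set over the moves into it, \<open>h\<close> spreads - 1 / (2 t) times the weight of
  the smaller set over the moves out of it, and they agree on every move.\<close>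

lemma total_step:
  "real (Suc n) * (\<Sum>S\<in>states (Suc n). total_wt S) = - 1 / (2 * of_int t) * (\<Sum>S\<in>states n. total_wt S)"
proof -
  let ?I = "{-half..t * int (Suc n)}"
  define lo where "lo S = {m. m \<in> ?I \<and> tgt m \<subseteq> S \<and> src m \<inter> S = {}}" for S
  define hi where "hi S = {m. m \<in> ?I \<and> src m \<subseteq> S \<and> tgt m \<inter> S = {}}" for S
  have fin: "finite (lo S)" "finite (hi S)" for S
    unfolding lo_def hi_def by (rule finite_interval_filter)+
  define g where "g S m = total_wt S * ((real (quo m) + 1) / (\<Prod>c\<in>S - tgt m. kap m c))" for S m
  define h where "h S m = (- 1 / of_int t ^ 2) * total_wt S *
      ((if m = 0 then 1 / 2 else 1) * (\<Prod>c\<in>S - src m. kap m c) / (real (quo m) + 1))" for S m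
  have "real (Suc n) * (\<Sum>S\<in>states (Suc n). total_wt S) = (\<Sum>S\<in>states (Suc n). \<Sum>m\<in>lo S. g S m)"
  proof -
    have "real (Suc n) * total_wt S = (\<Sum>m\<in>lo S. g S m)" if "S \<in> states (Suc n)" for S
      unfolding g_def sum_distrib_left[symmetric] lo_def down_moves[OF that] by simp
    then show ?thesis by (simp only: sum_distrib_left cong: sum.cong)
  qed
  also have "\<dots> = (\<Sum>(S, m)\<in>Sigma (states (Suc n)) lo. g S m)"
    using finite_states fin by (intro sum.Sigma) auto
  also have "\<dots> = (\<Sum>(S, m)\<in>Sigma (states n) hi. h S m)"
  proof (rule sum.reindex_bij_witness[of _ "\<lambda>(S, m). (S - src m \<union> tgt m, m)" "\<lambda>(S, m). (S - tgt m \<union> src m, m)"])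
    fix a assume a: "a \<in> Sigma (states n) hi"
    obtain S m where Sm: "a = (S, m)" by fastforce
    have S: "finite S" "\<And>u. u \<in> S \<Longrightarrow> 0 < u" "S \<in> states n" and m: "m \<in> ?I" "src m \<subseteq> S" "tgt m \<inter> S = {}"
      using a Sm by (auto simp: states_def hi_def)
    have C: "finite (S - src m)" "\<And>c. c \<in> S - src m \<Longrightarrow> 0 < c" "(S - src m) \<inter> src m = {}" "(S - src m) \<inter> tgt m = {}"
      using S m by auto
    have e: "S - src m \<union> src m = S" using m by auto
    have "S - src m \<union> tgt m \<in> states (Suc n)"
      using move_hooks[OF _ C] move_sum[OF _ C] m(1) S src_tgt(3)[of m] tgt_pos[of m] C(1)
      unfolding e by (auto simp: states_def algebra_simps)
    then show "(case a of (S, m) \<Rightarrow> (S - src m \<union> tgt m, m)) \<in> Sigma (states (Suc n)) lo"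
      using Sm m src_tgt[of m] by (auto simp: lo_def)
    show "(case case a of (S, m) \<Rightarrow> (S - src m \<union> tgt m, m) of (S, m) \<Rightarrow> (S - tgt m \<union> src m, m)) = a"
      using Sm m src_tgt[of m] by auto
  next
    fix a assume a: "a \<in> Sigma (states (Suc n)) lo"
    obtain S m where Sm: "a = (S, m)" by fastforce
    have S: "finite S" "\<And>u. u \<in> S \<Longrightarrow> 0 < u" "S \<in> states (Suc n)" and m: "m \<in> ?I" "tgt m \<subseteq> S" "src m \<inter> S = {}"
      using a Sm by (auto simp: states_def lo_def)
    define C where "C = S - tgt m"
    have C: "finite C" "\<And>c. c \<in> C \<Longrightarrow> 0 < c" "C \<inter> src m = {}" "C \<inter> tgt m = {}"
      using S m by (auto simp: C_def)
    have e: "C \<union> tgt m = S" "C \<union> src m - src m = C" using m by (auto simp: C_def)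
    have ml: "- half \<le> m" using m by simp
    have "C \<union> src m \<in> states n"
      using move_hooks[OF ml C] move_sum[OF ml C] S src_tgt(2)[of m] src_pos[of _ m] C(1,2)
      unfolding e by (auto simp: states_def algebra_simps)
    moreover have "(C \<union> src m) \<inter> tgt m = {}" using C src_tgt[of m] by auto
    ultimately show "(case a of (S, m) \<Rightarrow> (S - tgt m \<union> src m, m)) \<in> Sigma (states n) hi"
      using Sm m unfolding C_def by (auto simp: hi_def)
    show "(case case a of (S, m) \<Rightarrow> (S - tgt m \<union> src m, m) of (S, m) \<Rightarrow> (S - src m \<union> tgt m, m)) = a"
      using Sm m src_tgt[of m] by auto
    define K where "K = (\<Prod>c\<in>C. kap m c)"
    have "K \<noteq> 0"
    proof -
      have "kap m c \<noteq> 0" if "c \<in> C" for c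
        using C that by (intro kap_neq_0[OF ml]) auto
      then show ?thesis using C(1) by (simp add: K_def)
    qed
    \<comment> \<open>Here k / y is the square root of the variable part of the weight ratio:
      dividing the larger weight by it leaves one factor k / y on the smaller weight.\<close>
    have cancel: "\<tau> * A * (E * k / y) = A * \<tau> * E * k\<^sup>2 / y\<^sup>2 * (y / k)"
      if "k \<noteq> 0" "y \<noteq> 0" for A E k \<tau> y :: real
      using that by (simp add: power2_eq_square)
    have "total_wt S = total_wt (C \<union> src m) * (- 1 / of_int t ^ 2)
          * (if m = 0 then 1 / 2 else 1) * K\<^sup>2 / (real (quo m) + 1)\<^sup>2"
      using move_wt[OF ml C] unfolding e K_def .
    then have "h (C \<union> src m) m = g S m"
      unfolding h_def g_def e(2) C_def[symmetric] K_def[symmetric]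
      by (simp only:) (rule cancel[OF \<open>K \<noteq> 0\<close>], simp)
    then show "(case (case a of (S, m) \<Rightarrow> (S - tgt m \<union> src m, m)) of (S, m) \<Rightarrow> h S m) = (case a of (S, m) \<Rightarrow> g S m)"
      using Sm by (simp add: C_def)
  qed
  also have "\<dots> = (\<Sum>S\<in>states n. \<Sum>m\<in>hi S. h S m)"
    using finite_states fin by (intro sum.Sigma[symmetric]) auto
  also have "\<dots> = (\<Sum>S\<in>states n. (- 1 / of_int t ^ 2) * total_wt S * (of_int t / 2))"
    unfolding h_def sum_distrib_left[symmetric] hi_def by (intro sum.cong refl arg_cong2[where f="(*)"] up_moves)
  also have "\<dots> = - 1 / (2 * of_int t) * (\<Sum>S\<in>states n. total_wt S)"
    using t_pos by (simp add: sum_distrib_left sum_negf power2_eq_square field_simps)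
  finally show ?thesis .
qed

lemma total_states: "(\<Sum>S\<in>states n. total_wt S) = (-1) ^ n / (fact n * of_int t ^ n * 2 ^ n)"
proof (induction n)
  case 0
  show ?case by (simp add: states_0 total_wt_def)
next
  case (Suc n)
  have "(\<Sum>S\<in>states (Suc n). total_wt S) = - 1 / (2 * of_int t) * (\<Sum>S\<in>states n. total_wt S) / real (Suc n)"
    unfolding total_step[of n, symmetric] by (simp del: of_nat_Suc)
  then show ?case unfolding Suc.IH using t_pos by (simp add: field_simps del: of_nat_Suc)
qed

end

section \<open>Partitions and their edge sequences\<close>

text \<open>Used to recover the rows from the Maya set, and to match columns with negated
  rows.\<close>

lemma strict_antimono_image_unique:
  fixes f g :: "nat \<Rightarrow> int"
  assumes f: "\<And>i j. i \<in> A \<Longrightarrow> j \<in> A \<Longrightarrow> i < j \<Longrightarrow> f j < f i"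
    and g: "\<And>i j. i \<in> A \<Longrightarrow> j \<in> A \<Longrightarrow> i < j \<Longrightarrow> g j < g i"
    and img: "f ` A = g ` A" and i: "i \<in> A"
  shows "f i = g i"
  using i
proof (induction i rule: less_induct)
  case (less i)
  obtain k where k: "k \<in> A" "f i = g k" using img less.prems by blast
  obtain l where l: "l \<in> A" "g i = f l" using img less.prems by (metis imageE imageI)
  have "f i \<le> g i"
  proof (rule ccontr)
    assume "\<not> f i \<le> g i"
    then have "k < i" using k g[of i k] less.prems by (cases k i rule: linorder_cases) auto
    then show False using less.IH[of k] f[of k i] k less.prems by simp
  qed
  moreover have "g i \<le> f i"
  proof (rule ccontr)
    assume "\<not> g i \<le> f i"
    then have "l < i" using l f[of i l] less.prems by (cases l i rule: linorder_cases) auto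
    then show False using less.IH[of l] g[of l i] l less.prems by simp
  qed
  ultimately show ?case by simp
qed

lemma downset_card_iff:
  fixes A :: "nat set"
  assumes fin: "finite A" and pos: "\<And>i. i \<in> A \<Longrightarrow> 1 \<le> i"
    and down: "\<And>i j. j \<in> A \<Longrightarrow> 1 \<le> i \<Longrightarrow> i \<le> j \<Longrightarrow> i \<in> A"
    and i: "1 \<le> i"
  shows "i \<in> A \<longleftrightarrow> i \<le> card A"
proof
  assume "i \<in> A"
  then have "{1..i} \<subseteq> A" using down by auto
  then show "i \<le> card A" using card_mono[OF fin, of "{1..i}"] by simp
next
  assume le: "i \<le> card A"
  show "i \<in> A"
  proof (rule ccontr)
    assume "i \<notin> A"
    have "x < i" if "x \<in> A" for x
      using down[OF that i] \<open>i \<notin> A\<close> by (cases "x < i") auto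
    then have "A \<subseteq> {1..<i}" using pos by auto
    then have "card A \<le> card {1..<i}" by (intro card_mono) auto
    then show False using le i by simp
  qed
qed

lemma part_antimono:
  assumes "is_partition la" "1 \<le> i" "i \<le> j"
  shows "part la j \<le> part la i"
proof (cases "i < j \<and> j \<le> length la")
  case True
  then show ?thesis using assms sorted_wrt_nth_less[of "(\<ge>)" la "i - 1" "j - 1"]
    by (auto simp: part_def is_partition_def)
next
  case False
  then show ?thesis using assms by (cases "i = j") (auto simp: part_def)
qed

lemma part_pos_iff: "is_partition la \<Longrightarrow> 0 < part la i \<longleftrightarrow> 1 \<le> i \<and> i \<le> length la"
  by (auto simp: part_def is_partition_def)

lemma finite_rows: "1 \<le> j \<Longrightarrow> finite {i. 1 \<le> i \<and> j \<le> part la i}"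
  by (rule finite_subset[of _ "{1..length la}"]) (auto simp: part_def split: if_splits)

lemma part_conj_partition:
  assumes "is_partition la" "1 \<le> j"
  shows "part (conj_partition la) j = card {i. 1 \<le> i \<and> j \<le> part la i}"
proof -
  have eq: "{i. 1 \<le> i \<and> i \<le> length la \<and> j \<le> part la i} = {i. 1 \<le> i \<and> j \<le> part la i}"
    using assms(2) by (auto simp: part_def split: if_splits)
  show ?thesis
  proof (cases "j \<le> part la 1")
    case True
    then have "[1..<Suc (part la 1)] ! (j - 1) = j" using assms(2) by (subst nth_upt) auto
    then show ?thesis using assms(2) eq True
      by (simp add: conj_partition_def part_def[of "map _ _"] del: upt_Suc)
  next
    case False
    then have "{i. 1 \<le> i \<and> j \<le> part la i} = {}"
      using part_antimono[OF assms(1), of 1] by fastforce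
    then have "card {i. 1 \<le> i \<and> j \<le> part la i} = 0" by (simp only: card.empty)
    moreover have "part (conj_partition la) j = 0"
      using False by (simp add: conj_partition_def part_def[of "map _ _"] del: upt_Suc)
    ultimately show ?thesis by (simp only:)
  qed
qed

lemma conj_iff:
  assumes "is_partition la" "1 \<le> i" "1 \<le> j"
  shows "i \<le> part (conj_partition la) j \<longleftrightarrow> j \<le> part la i"
proof -
  have "i \<in> {i. 1 \<le> i \<and> j \<le> part la i} \<longleftrightarrow> i \<le> card {i. 1 \<le> i \<and> j \<le> part la i}"
  proof (rule downset_card_iff)
    fix k l assume "l \<in> {i. 1 \<le> i \<and> j \<le> part la i}" "1 \<le> k" "k \<le> l"
    then show "k \<in> {i. 1 \<le> i \<and> j \<le> part la i}"
      using part_antimono[OF assms(1), of k l] by auto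
  qed (use finite_rows assms in auto)
  then show ?thesis using assms(2) by (simp add: part_conj_partition[OF assms(1,3)])
qed

lemma durfee_iff:
  assumes "is_partition la" "1 \<le> i"
  shows "i \<le> part la i \<longleftrightarrow> i \<le> durfee la"
proof -
  have "i \<in> {i. 1 \<le> i \<and> i \<le> part la i} \<longleftrightarrow> i \<le> card {i. 1 \<le> i \<and> i \<le> part la i}"
  proof (rule downset_card_iff)
    show "finite {i. 1 \<le> i \<and> i \<le> part la i}"
      by (rule finite_subset[OF _ finite_rows[of 1 la]]) auto
    fix k l assume "l \<in> {i. 1 \<le> i \<and> i \<le> part la i}" "1 \<le> k" "k \<le> l"
    then show "k \<in> {i. 1 \<le> i \<and> i \<le> part la i}"
      using part_antimono[OF assms(1), of k l] by auto
  qed (use assms in auto)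
  then show ?thesis using assms(2) by (simp add: durfee_def)
qed

text \<open>The edge sequence of the diagram: rows are the elements of the Maya set, columns those of its
  complement, and the hook length of a box is the difference of the two.\<close>

definition row :: "nat list \<Rightarrow> nat \<Rightarrow> int" where
  "row la i = int (part la i) - int i"

definition col :: "nat list \<Rightarrow> nat \<Rightarrow> int" where
  "col la j = int j - 1 - int (part (conj_partition la) j)"

definition maya :: "nat list \<Rightarrow> int set" where
  "maya la = row la ` {1..}"

context
  fixes la :: "nat list"
  assumes la: "is_partition la"
begin

lemma row_strict: "1 \<le> i \<Longrightarrow> i < j \<Longrightarrow> row la j < row la i"
  using part_antimono[OF la, of i j] by (simp add: row_def)

lemma row_less_iff: "1 \<le> i \<Longrightarrow> 1 \<le> j \<Longrightarrow> row la j < row la i \<longleftrightarrow> i < j"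
  using row_strict[of i j] row_strict[of j i] by (cases i j rule: linorder_cases) auto

lemma col_strict:
  assumes "1 \<le> i" "i < j"
  shows "col la i < col la j"
proof -
  have "part (conj_partition la) j \<le> part (conj_partition la) i"
  proof (cases "part (conj_partition la) j = 0")
    case False
    then show ?thesis
      using conj_iff[OF la, of "part (conj_partition la) j" j]
        conj_iff[OF la, of "part (conj_partition la) j" i] assms by simp
  qed simp
  then show ?thesis using assms by (simp add: col_def)
qed

lemma box_iff: "1 \<le> i \<Longrightarrow> 1 \<le> j \<Longrightarrow> j \<le> part la i \<longleftrightarrow> col la j < row la i"
  using conj_iff[OF la, of i j] by (auto simp: row_def col_def)

lemma row_neq_col: "1 \<le> i \<Longrightarrow> 1 \<le> j \<Longrightarrow> row la i \<noteq> col la j"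
  using conj_iff[OF la, of i j] by (auto simp: row_def col_def)

lemma row_or_col:
  obtains i where "1 \<le> i" "z = row la i" | j where "1 \<le> j" "z = col la j"
proof -
  \<comment> \<open>Exactly \<open>i - 1\<close> rows exceed \<open>z\<close>. If \<open>z\<close>
    is not a row, column \<open>z + i\<close> has length \<open>i - 1\<close>, which places its edge
    at \<open>z\<close>.\<close>
  define i where "i = (LEAST i. 1 \<le> i \<and> row la i \<le> z)"
  have "\<exists>i. 1 \<le> i \<and> row la i \<le> z"
  proof (intro exI conjI)
    show "row la (length la + nat \<bar>z\<bar> + 1) \<le> z" by (simp add: row_def part_def)
  qed simp
  then have i: "1 \<le> i" "row la i \<le> z" unfolding i_def by (metis (mono_tags, lifting) LeastI_ex)+
  have least: "i \<le> k" if "1 \<le> k" "row la k \<le> z" for k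
    unfolding i_def using that by (intro Least_le) auto
  show thesis
  proof (cases "row la i = z")
    case True
    then show thesis using i that(1) by auto
  next
    case False
    define j where "j = nat (z + int i)"
    have j: "1 \<le> j" "int j = z + int i" "part la i < j"
      using i False by (auto simp: j_def row_def)
    have "part (conj_partition la) j = i - 1"
    proof (cases "i = 1")
      case True
      have "\<not> 1 \<le> part (conj_partition la) j" using conj_iff[OF la, of 1 j] j True by simp
      then show ?thesis using True by simp
    next
      case False
      then have "1 \<le> i - 1" using i by simp
      then have "\<not> row la (i - 1) \<le> z" using least[of "i - 1"] by auto
      then have "j \<le> part la (i - 1)" using \<open>1 \<le> i - 1\<close> i j by (auto simp: row_def)
      then have "i - 1 \<le> part (conj_partition la) j"
        using conj_iff[OF la \<open>1 \<le> i - 1\<close> j(1)] by simp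
      moreover have "\<not> i \<le> part (conj_partition la) j" using conj_iff[OF la i(1) j(1)] j by simp
      ultimately show ?thesis by simp
    qed
    then have "z = col la j" using i j by (simp add: col_def)
    then show thesis using j that(2) by blast
  qed
qed

lemma notin_maya_iff: "z \<notin> maya la \<longleftrightarrow> (\<exists>j\<ge>1. z = col la j)"
proof
  assume "z \<notin> maya la"
  then show "\<exists>j\<ge>1. z = col la j" by (cases rule: row_or_col[of z]) (auto simp: maya_def)
next
  assume "\<exists>j\<ge>1. z = col la j"
  then obtain j where j: "1 \<le> j" "z = col la j" by blast
  then have "row la i \<noteq> z" if "1 \<le> i" for i using row_neq_col[OF that j(1)] by simp
  then show "z \<notin> maya la" by (force simp: maya_def)
qed

lemma boxes_eq: "boxes la = {(i, j). 1 \<le> i \<and> 1 \<le> j \<and> j \<le> part la i}"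
  using part_pos_iff[OF la] by (fastforce simp: boxes_def)

lemma hook_length_eq: "(i, j) \<in> boxes la \<Longrightarrow> int (hook_length la (i, j)) = row la i - col la j"
  using conj_iff[OF la, of i j] by (auto simp: boxes_eq hook_length_def row_def col_def)

lemma bij_hook_boxes:
  "bij_betw (\<lambda>(i, j). (row la i, col la j)) (hook_boxes t la)
     {(x, y). x \<in> maya la \<and> y \<notin> maya la \<and> y < x \<and> int t dvd x - y}"
proof (rule bij_betwI')
  fix a b assume "a \<in> hook_boxes t la" "b \<in> hook_boxes t la"
  then obtain i j k l where ij: "a = (i, j)" "b = (k, l)" "1 \<le> i" "1 \<le> j" "1 \<le> k" "1 \<le> l"
    by (auto simp: hook_boxes_def boxes_eq)
  then show "((case a of (i, j) \<Rightarrow> (row la i, col la j)) = (case b of (i, j) \<Rightarrow> (row la i, col la j))) = (a = b)"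
    using row_strict[of i k] row_strict[of k i] col_strict[of j l] col_strict[of l j]
    by (cases i k rule: linorder_cases; cases j l rule: linorder_cases) auto
next
  fix a assume a: "a \<in> hook_boxes t la"
  then obtain i j where ij: "a = (i, j)" "1 \<le> i" "1 \<le> j" "j \<le> part la i"
    by (auto simp: hook_boxes_def boxes_eq)
  have "int t dvd row la i - col la j"
    using a ij hook_length_eq[of i j] int_dvd_int_iff[of t "hook_length la (i, j)"] by (simp add: hook_boxes_def)
  then show "(case a of (i, j) \<Rightarrow> (row la i, col la j)) \<in> {(x, y). x \<in> maya la \<and> y \<notin> maya la \<and> y < x \<and> int t dvd x - y}"
    using ij box_iff[of i j] notin_maya_iff by (auto simp: maya_def)
next
  fix p assume p: "p \<in> {(x, y). x \<in> maya la \<and> y \<notin> maya la \<and> y < x \<and> int t dvd x - y}"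
  then obtain i j where ij: "1 \<le> i" "1 \<le> j" "p = (row la i, col la j)"
    using notin_maya_iff by (auto simp: maya_def)
  then have box: "(i, j) \<in> boxes la" using p box_iff[of i j] by (auto simp: boxes_eq)
  have "(i, j) \<in> hook_boxes t la"
    using p ij box hook_length_eq[OF box] int_dvd_int_iff[of t "hook_length la (i, j)"]
    by (simp add: hook_boxes_def)
  then show "\<exists>a\<in>hook_boxes t la. p = (case a of (i, j) \<Rightarrow> (row la i, col la j))"
    using ij by (intro bexI[of _ "(i, j)"]) auto
qed

lemma row_nonneg_iff: "1 \<le> i \<Longrightarrow> 0 \<le> row la i \<longleftrightarrow> i \<le> durfee la"
  using durfee_iff[OF la, of i] by (simp add: row_def)

lemma col_neg_iff: "1 \<le> j \<Longrightarrow> col la j < 0 \<longleftrightarrow> j \<le> durfee la"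
  using durfee_iff[OF la, of j] conj_iff[OF la, of j j] by (auto simp: col_def)

text \<open>By the offset in \<open>col\<close>, a part that exceeds its conjugate by 1 means that
  the two edges are opposite integers.\<close>

lemma DD_iff: "la \<in> DD \<longleftrightarrow> (\<forall>i. 1 \<le> i \<and> i \<le> durfee la \<longrightarrow> col la i = - row la i)"
  using la by (auto simp: DD_def col_def row_def)

lemma card_boxes: "card (boxes la) = weight la"
proof -
  have "boxes la = Sigma {1..length la} (\<lambda>i. {1..part la i})"
    by (auto simp: boxes_def)
  then have "card (boxes la) = (\<Sum>i\<in>{1..length la}. part la i)"
    by simp
  also have "\<dots> = (\<Sum>i<length la. la ! i)"
    by (rule sum.reindex_bij_witness[of _ Suc "\<lambda>i. i - 1"]) (auto simp: part_def)
  also have "\<dots> = weight la" by (simp add: weight_def sum_list_sum_nth lessThan_atLeast0)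
  finally show ?thesis .
qed

end

section \<open>Doubled distinct partitions as finite sets of positive integers\<close>

definition frob :: "nat list \<Rightarrow> int set" where
  "frob la = {u \<in> maya la. 0 < u}"

text \<open>For positive \<open>S\<close>, the edge sequence that negation complements everywhere
  except at 0, which belongs to the columns.\<close>

definition sym_maya :: "int set \<Rightarrow> int set" where
  "sym_maya S = S \<union> {z. z < 0 \<and> - z \<notin> S}"

text \<open>Up to the Durfee length, row and column edges are opposite, so negation exchanges rows
  and columns. For the sign: if \<open>j\<close> is at most the Durfee length,
  \<open>row la i + col la j\<close> is a difference of two rows, negative exactly for
  \<open>i > j\<close>; otherwise both edges are nonnegative and \<open>i\<close> is at most the
  Durfee length, hence less than \<open>j\<close>.\<close>

lemma
  assumes D: "la \<in> DD"
  shows maya_DD: "maya la = sym_maya (frob la)"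
    and card_frob: "card (frob la) = durfee la"
    and finite_frob: "finite (frob la)"
    and hook_sign_DD: "(i, j) \<in> boxes la \<Longrightarrow> hook_sign (i, j) = (if row la i + col la j < 0 then -1 else 1)"
proof -
  have la: "is_partition la" using D by (simp add: DD_def)
  have cr: "col la i = - row la i" if "1 \<le> i" "i \<le> durfee la" for i
    using D DD_iff[OF la] that by blast
  have pos: "0 < row la i" if "1 \<le> i" "i \<le> durfee la" for i
    using col_neg_iff[OF la that(1)] cr[OF that] that by simp
  have zero: "0 \<notin> maya la"
  proof
    assume "0 \<in> maya la"
    then obtain i where "1 \<le> i" "row la i = 0" by (auto simp: maya_def)
    then show False using row_nonneg_iff[OF la, of i] pos[of i] by simp
  qed
  have img: "frob la = row la ` {1..durfee la}"
    using row_nonneg_iff[OF la] pos by (force simp: frob_def maya_def)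
  show fin: "finite (frob la)" by (simp add: img)
  have "inj_on (row la) {1..durfee la}"
    by (rule inj_onI) (use row_less_iff[OF la] in \<open>metis atLeastAtMost_iff less_irrefl linorder_less_linear\<close>)
  then show "card (frob la) = durfee la" by (simp add: img card_image)
  have neg: "z \<notin> maya la \<longleftrightarrow> - z \<in> maya la" if "z < 0" for z
  proof
    assume "z \<notin> maya la"
    then obtain j where j: "1 \<le> j" "z = col la j" using notin_maya_iff[OF la] by blast
    then have "j \<le> durfee la" using that col_neg_iff[OF la] by simp
    then show "- z \<in> maya la" using j cr by (auto simp: maya_def)
  next
    assume "- z \<in> maya la"
    then obtain i where i: "1 \<le> i" "- z = row la i" by (auto simp: maya_def)
    then have "i \<le> durfee la" using that row_nonneg_iff[OF la, of i] by simp
    then have "z = col la i" using i cr[of i] by simp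
    then show "z \<notin> maya la" using i notin_maya_iff[OF la] by blast
  qed
  show "maya la = sym_maya (frob la)"
  proof (rule set_eqI)
    fix z show "z \<in> maya la \<longleftrightarrow> z \<in> sym_maya (frob la)"
      using neg[of z] zero by (cases z "0::int" rule: linorder_cases) (auto simp: sym_maya_def frob_def)
  qed
  assume "(i, j) \<in> boxes la"
  then have ij: "1 \<le> i" "1 \<le> j" "col la j < row la i"
    using box_iff[OF la] by (auto simp: boxes_eq[OF la])
  show "hook_sign (i, j) = (if row la i + col la j < 0 then -1 else 1)"
  proof (cases "j \<le> durfee la")
    case True
    then show ?thesis using ij cr row_less_iff[OF la, of j i] by (simp add: hook_sign_def)
  next
    case False
    then have "0 \<le> col la j" using col_neg_iff[OF la, of j] ij by simp
    moreover from this have "i \<le> durfee la" using ij row_nonneg_iff[OF la, of i] by simp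
    ultimately show ?thesis using ij False by (simp add: hook_sign_def)
  qed
qed

lemma inj_frob: "inj_on frob DD"
proof (rule inj_onI)
  fix la mu assume DD: "la \<in> DD" "mu \<in> DD" "frob la = frob mu"
  then have p: "is_partition la" "is_partition mu" by (auto simp: DD_def)
  have "row la ` {1..} = row mu ` {1..}"
    using maya_DD[OF DD(1)] maya_DD[OF DD(2)] DD(3) by (simp add: maya_def)
  then have "row la i = row mu i" if "1 \<le> i" for i
    using row_strict[OF p(1)] row_strict[OF p(2)] that
    by (intro strict_antimono_image_unique[of "{1..}"]) auto
  then have part: "part la i = part mu i" if "1 \<le> i" for i
    using that by (simp add: row_def)
  have "length la = length mu"
    using part part_pos_iff[OF p(1)] part_pos_iff[OF p(2)]
    by (metis le_antisym nat_le_linear not_less_eq_eq le_SucI Suc_leI le0 One_nat_def)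
  then show "la = mu"
  proof (rule nth_equalityI)
    fix k assume "k < length la"
    then show "la ! k = mu ! k" using part[of "Suc k"] \<open>length la = length mu\<close> by (simp add: part_def)
  qed
qed

text \<open>In a decreasing list the zeros come last, so dropping them moves no positive
  part.\<close>

lemma part_filter_pos:
  assumes "sorted_wrt (\<ge>) ys"
  shows "part (filter (\<lambda>x. 0 < x) ys) i = (if 1 \<le> i \<and> i \<le> length ys then ys ! (i - 1) else 0)"
  using assms
proof (induction ys arbitrary: i)
  case (Cons y ys)
  show ?case
  proof (cases "0 < y")
    case True
    then have "part (filter (\<lambda>x. 0 < x) (y # ys)) i
        = (if i = 1 then y else part (filter (\<lambda>x. 0 < x) ys) (i - 1))"
      by (cases i) (auto simp: part_def nth_Cons')
    then show ?thesis using Cons by (auto simp: nth_Cons' Suc_le_eq)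
  next
    case False
    then have z: "\<forall>x\<in>set (y # ys). x = 0" using Cons.prems by auto
    then have "filter (\<lambda>x. 0 < x) (y # ys) = []" by (simp add: filter_empty_conv)
    moreover have "(y # ys) ! (i - 1) = 0" if "1 \<le> i" "i \<le> length (y # ys)"
      using z nth_mem[of "i - 1" "y # ys"] that by (metis Suc_diff_1 Suc_le_eq less_eq_Suc_le One_nat_def)
    ultimately show ?thesis by (simp add: part_def)
  qed
qed (simp add: part_def)

text \<open>\<open>sym_maya S\<close> is listed in decreasing order, and its i-th element plus i
  becomes the i-th part. Below - K the set is full, so all later parts vanish.\<close>

lemma frob_surj:
  assumes S: "finite S" "\<And>u. u \<in> S \<Longrightarrow> 0 < u"
  obtains la where "la \<in> DD" "frob la = S"
proof -
  obtain K where K: "\<And>u. u \<in> S \<Longrightarrow> u \<le> int K"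
    using S(1) by (metis Max_ge int_nat_eq linorder_le_cases order_trans)
  define X where "X = {z \<in> sym_maya S. - int K \<le> z}"
  have X: "X = S \<union> ({- int K..-1} - uminus ` S)"
    using S(2) by (force simp: X_def sym_maya_def)
  have finX: "finite X" using S by (simp add: X)
  \<comment> \<open>Each \<open>u\<close> in \<open>S\<close> replaces \<open>- u\<close>, so the
    window has as many elements as negative integers; the list then continues at row
    \<open>K + 1\<close> with edge \<open>- int K - 1\<close>, a part 0.\<close>
  have "card X = K"
  proof -
    have "uminus ` S \<subseteq> {- int K..-1}" using K S(2) by force
    then have "card ({- int K..-1} - uminus ` S) = K - card S"
      using S(1) by (simp add: card_Diff_subset card_image)
    moreover have "card (uminus ` S) \<le> card {- int K..-1}" using \<open>uminus ` S \<subseteq> _\<close> by (intro card_mono) auto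
    then have "card S \<le> K" by (simp add: card_image)
    moreover have "card X = card S + card ({- int K..-1} - uminus ` S)"
      unfolding X using S by (intro card_Un_disjoint) force+
    ultimately show ?thesis by simp
  qed
  define xs where "xs = rev (sorted_list_of_set X)"
  have xs: "sorted_wrt (>) xs" "set xs = X" "length xs = K"
    using finX \<open>card X = K\<close> strict_sorted_list_of_set[of X] by (simp_all add: xs_def sorted_wrt_rev)
  \<comment> \<open>Downward from the last entry, which is at least - K. This makes
    \<open>nat\<close> exact in \<open>ys\<close>.\<close>
  have lb: "- int (Suc k) \<le> xs ! k" if "k < K" for k
  proof -
    have "k \<le> K - 1" using that by simp
    then show ?thesis
    proof (induction k rule: inc_induct)
      case base
      have "xs ! (K - 1) \<in> X" using that xs(2,3) by (metis diff_less nth_mem zero_less_one gr_implies_not0 neq0_conv)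
      then show ?case using that by (simp add: X_def)
    next
      case (step k)
      have "xs ! Suc k < xs ! k" using sorted_wrt_nth_less[OF xs(1), of k "Suc k"] xs(3) step.hyps by simp
      then show ?case using step.IH by simp
    qed
  qed
  define ys where "ys = map (\<lambda>k. nat (xs ! k + int (Suc k))) [0..<K]"
  have ys: "sorted_wrt (\<ge>) ys"
  proof (unfold sorted_wrt_iff_nth_less, intro allI impI)
    fix k l assume kl: "k < l" "l < length ys"
    have "xs ! l + int l \<le> xs ! k + int k"
    proof -
      have "l \<le> K - 1" using kl by (simp add: ys_def)
      have "k \<le> l" using kl by simp
      then show ?thesis
      proof (induction k rule: inc_induct)
        case (step k)
        have "xs ! Suc k < xs ! k"
          using sorted_wrt_nth_less[OF xs(1), of k "Suc k"] xs(3) step.hyps kl by (simp add: ys_def)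
        then show ?case using step.IH by simp
      qed simp
    qed
    then show "ys ! l \<le> ys ! k" using kl by (simp add: ys_def)
  qed
  define la where "la = filter (\<lambda>x. 0 < x) ys"
  have la: "is_partition la"
    unfolding is_partition_def la_def using ys by (simp add: sorted_wrt_filter)
  have row: "row la i = (if i \<le> K then xs ! (i - 1) else - int i)" if "1 \<le> i" for i
  proof -
    have "part la i = (if i \<le> K then ys ! (i - 1) else 0)"
      unfolding la_def using part_filter_pos[OF ys, of i] that by (simp add: ys_def)
    moreover have "int (ys ! (i - 1)) = xs ! (i - 1) + int i" if "i \<le> K"
    proof -
      have "i - 1 < K" using that \<open>1 \<le> i\<close> by linarith
      then show ?thesis using lb[of "i - 1"] \<open>1 \<le> i\<close> by (simp add: ys_def)
    qed
    ultimately show ?thesis by (simp add: row_def)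
  qed
  have maya: "maya la = sym_maya S"
  proof -
    have "row la ` {1..} = row la ` {1..K} \<union> row la ` {K<..}"
      unfolding image_Un[symmetric] by (intro arg_cong[where f="image _"]) auto
    also have "row la ` {1..K} = X"
    proof -
      have "{1..K} = Suc ` {0..<K}"
        by (simp add: image_Suc_atLeastLessThan atLeastLessThanSuc_atLeastAtMost)
      then have "row la ` {1..K} = (\<lambda>k. row la (Suc k)) ` {0..<K}"
        by (simp only: image_image)
      also have "\<dots> = (\<lambda>k. xs ! k) ` {0..<K}"
        using row by (intro image_cong) auto
      also have "\<dots> = X" using xs(2,3) nth_image[of K xs] by simp
      finally show ?thesis .
    qed
    also have "row la ` {K<..} = {z. z < - int K}"
    proof (rule set_eqI)
      fix z
      have "z = row la (nat (- z))" if "z < - int K"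
      proof -
        have "1 \<le> nat (- z)" "\<not> nat (- z) \<le> K" using that by linarith+
        then show ?thesis using row[of "nat (- z)"] that by simp
      qed
      then show "z \<in> row la ` {K<..} \<longleftrightarrow> z \<in> {z. z < - int K}"
        using row by (auto intro!: image_eqI[of _ _ "nat (- z)"])
    qed
    also have "X \<union> {z. z < - int K} = sym_maya S"
      using K by (force simp: X_def sym_maya_def)
    finally show ?thesis by (simp add: maya_def)
  qed
  have frob: "frob la = S"
    using S(2) by (auto simp: frob_def maya sym_maya_def dest: S(2))
  have "la \<in> DD"
    unfolding DD_iff[OF la]
  proof (intro allI impI)
    fix i assume i: "1 \<le> i \<and> i \<le> durfee la"
    have nn: "0 \<notin> S" using S(2) by blast
    \<comment> \<open>Both sides are \<open>S\<close>, enumerated in decreasing order.\<close>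
    have "(\<lambda>j. - col la j) ` {1..durfee la} = row la ` {1..durfee la}"
    proof (rule set_eqI)
      fix z
      have "z \<in> (\<lambda>j. - col la j) ` {1..durfee la} \<longleftrightarrow> 0 < z \<and> - z \<notin> maya la"
      proof
        assume "z \<in> (\<lambda>j. - col la j) ` {1..durfee la}"
        then obtain j where j: "1 \<le> j" "j \<le> durfee la" "- z = col la j" by auto
        then have "- z \<notin> maya la" unfolding notin_maya_iff[OF la] by blast
        then show "0 < z \<and> - z \<notin> maya la" using j col_neg_iff[OF la, of j] by simp
      next
        assume z: "0 < z \<and> - z \<notin> maya la"
        then obtain j where j: "1 \<le> j" "- z = col la j" using notin_maya_iff[OF la] by blast
        moreover from this have "j \<le> durfee la" using z col_neg_iff[OF la, of j] by simp
        ultimately show "z \<in> (\<lambda>j. - col la j) ` {1..durfee la}" by (intro image_eqI[of _ _ j]) auto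
      qed
      also have "\<dots> \<longleftrightarrow> z \<in> S" using S(2)[of z] S(2)[of "- z"] by (auto simp: maya sym_maya_def dest: S(2))
      also have "\<dots> \<longleftrightarrow> z \<in> maya la \<and> 0 \<le> z" using nn S(2) by (auto simp: maya sym_maya_def dest: S(2))
      also have "\<dots> \<longleftrightarrow> z \<in> row la ` {1..durfee la}"
        using row_nonneg_iff[OF la] by (auto simp: maya_def)
      finally show "z \<in> (\<lambda>j. - col la j) ` {1..durfee la} \<longleftrightarrow> z \<in> row la ` {1..durfee la}" .
    qed
    then have "- col la i = row la i"
      using i row_strict[OF la] col_strict[OF la]
      by (intro strict_antimono_image_unique[of "{1..durfee la}"]) auto
    then show "col la i = - row la i" by simp
  qed
  then show thesis using that frob by blast
qed

section \<open>Hook products of doubled distinct partitions\<close>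

definition hook_pairs :: "int \<Rightarrow> int set \<Rightarrow> (int \<times> int) set" where
  "hook_pairs t S = {(x, y). x \<in> sym_maya S \<and> y \<notin> sym_maya S \<and> y < x \<and> t dvd x - y}"

text \<open>The families are: both edges nonnegative, edges of different sign, both negative.
  Negation expresses each through \<open>S\<close>. The interval starts at 0 in the first family but
  at 1 in the third, because 0 is a column edge and not a row edge.\<close>

lemma hook_pairs_Un:
  assumes "\<And>u. u \<in> S \<Longrightarrow> 0 < u"
  shows "hook_pairs t S = Sigma S (\<lambda>u. {y \<in> {0..<u} - S. t dvd u - y})
    \<union> ((\<lambda>(u, v). (u, - v)) ` Sigma S (\<lambda>u. {v \<in> S. t dvd u + v})
    \<union> (\<lambda>(v, m). (- m, - v)) ` Sigma S (\<lambda>v. {m \<in> {1..<v} - S. t dvd v - m}))" (is "_ = ?A \<union> (?B \<union> ?C)")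
proof (intro equalityI subsetI)
  fix p assume "p \<in> hook_pairs t S"
  then obtain x y where p: "p = (x, y)" "x \<in> sym_maya S" "y \<notin> sym_maya S" "y < x" "t dvd x - y"
    by (auto simp: hook_pairs_def)
  have y: "y \<notin> S" "0 \<le> y \<or> - y \<in> S" using p(3) by (auto simp: sym_maya_def)
  consider "x \<in> S" "0 \<le> y" | "x \<in> S" "- y \<in> S" | "x < 0" "- x \<notin> S" "- y \<in> S"
    using p(2,4) y by (auto simp: sym_maya_def)
  then show "p \<in> ?A \<union> (?B \<union> ?C)"
  proof cases
    case 1
    then show ?thesis using p y by auto
  next
    case 2
    then have "p \<in> ?B" using p by (intro image_eqI[of _ _ "(x, - y)"]) auto
    then show ?thesis by blast
  next
    case 3
    then have "p \<in> ?C" using p by (intro image_eqI[of _ _ "(- y, - x)"]) auto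
    then show ?thesis by blast
  qed
next
  fix p assume "p \<in> ?A \<union> (?B \<union> ?C)"
  then consider "p \<in> ?A" | "p \<in> ?B" | "p \<in> ?C" by blast
  then show "p \<in> hook_pairs t S"
  proof cases
    case 1
    then show ?thesis by (auto simp: hook_pairs_def sym_maya_def)
  next
    case 2
    then obtain u v where "p = (u, - v)" "u \<in> S" "v \<in> S" "t dvd u + v" by auto
    then show ?thesis using assms[of u] assms[of v] assms[of "- v"]
      by (auto simp: hook_pairs_def sym_maya_def)
  next
    case 3
    then obtain v m where "p = (- m, - v)" "v \<in> S" "1 \<le> m" "m < v" "m \<notin> S" "t dvd v - m" by auto
    then show ?thesis using assms[of v] assms[of "- v"]
      by (auto simp: hook_pairs_def sym_maya_def)
  qed
qed

context comm_monoid_set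
begin

text \<open>Serves the hook product multiplicatively and the hook count additively.\<close>

lemma hook_pairs_decomp:
  assumes S: "finite S" "\<And>u. u \<in> S \<Longrightarrow> 0 < u"
  shows "F (\<lambda>(x, y). w x y) (hook_pairs t S)
    = F (\<lambda>u. F (w u) {y \<in> {0..<u} - S. t dvd u - y}) S \<^bold>*
      (F (\<lambda>u. F (\<lambda>v. w u (- v)) {v \<in> S. t dvd u + v}) S \<^bold>*
       F (\<lambda>v. F (\<lambda>m. w (- m) (- v)) {m \<in> {1..<v} - S. t dvd v - m}) S)"
proof -
  let ?A = "Sigma S (\<lambda>u. {y \<in> {0..<u} - S. t dvd u - y})"
  let ?U = "Sigma S (\<lambda>u. {v \<in> S. t dvd u + v})"
  let ?V = "Sigma S (\<lambda>v. {m \<in> {1..<v} - S. t dvd v - m})"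
  let ?B = "(\<lambda>(u, v). (u, - v)) ` ?U"
  let ?C = "(\<lambda>(v, m). (- m, - v)) ` ?V"
  have fin0: "finite {y \<in> {a..<b} - S. P y}" for a b :: int and P
    by (rule finite_subset[of _ "{a..<b}"]) auto
  have fin: "finite ?A" "finite ?U" "finite ?V"
    using S(1) fin0 by (simp_all add: finite_SigmaI)
  have Un: "hook_pairs t S = ?A \<union> (?B \<union> ?C)" by (rule hook_pairs_Un) (rule S(2))
  have disj: "?A \<inter> (?B \<union> ?C) = {}" "?B \<inter> ?C = {}" using S(2) by force+
  have 1: "F (\<lambda>(x, y). w x y) (?A \<union> (?B \<union> ?C)) = F (\<lambda>(x, y). w x y) ?A \<^bold>* F (\<lambda>(x, y). w x y) (?B \<union> ?C)"
    by (rule union_disjoint[OF fin(1) _ disj(1)]) (use fin in simp)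
  have 2: "F (\<lambda>(x, y). w x y) (?B \<union> ?C) = F (\<lambda>(x, y). w x y) ?B \<^bold>* F (\<lambda>(x, y). w x y) ?C"
    by (rule union_disjoint[OF _ _ disj(2)]) (use fin in simp_all)
  have "F (\<lambda>(x, y). w x y) (hook_pairs t S)
      = F (\<lambda>(x, y). w x y) ?A \<^bold>* (F (\<lambda>(x, y). w x y) ?B \<^bold>* F (\<lambda>(x, y). w x y) ?C)"
    unfolding Un 1 2 ..
  also have "F (\<lambda>(x, y). w x y) ?B = F ((\<lambda>(x, y). w x y) \<circ> (\<lambda>(u, v). (u, - v))) ?U"
    by (rule reindex) (auto simp: inj_on_def)
  also have "F (\<lambda>(x, y). w x y) ?C = F ((\<lambda>(x, y). w x y) \<circ> (\<lambda>(v, m). (- m, - v))) ?V"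
    by (rule reindex) (auto simp: inj_on_def)
  also have "(\<lambda>(x, y). w x y) \<circ> (\<lambda>(u, v). (u, - v)) = (\<lambda>(u, v). w u (- v))"
    by auto
  also have "(\<lambda>(x, y). w x y) \<circ> (\<lambda>(v, m). (- m, - v)) = (\<lambda>(v, m). w (- m) (- v))"
    by auto
  finally show ?thesis
    using S(1) fin0 by (subst (1 2 3) Sigma) auto
qed

lemma square_decomp:
  fixes S :: "'b::linorder set"
  assumes "finite S"
  shows "F (\<lambda>u. F (h u) S) S = F (\<lambda>u. h u u) S \<^bold>* F (\<lambda>u. F (\<lambda>v. h u v \<^bold>* h v u) {v \<in> S. v < u}) S"
proof -
  have "F (h u) S = h u u \<^bold>* (F (h u) {v \<in> S. v < u} \<^bold>* F (h u) {v \<in> S. u < v})" if u: "u \<in> S" for u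
  proof -
    have "S = insert u ({v \<in> S. v < u} \<union> {v \<in> S. u < v})" using u by auto
    then have "F (h u) S = F (h u) (insert u ({v \<in> S. v < u} \<union> {v \<in> S. u < v}))" by (rule arg_cong)
    also have "\<dots> = h u u \<^bold>* F (h u) ({v \<in> S. v < u} \<union> {v \<in> S. u < v})"
      using assms by (subst insert) auto
    also have "F (h u) ({v \<in> S. v < u} \<union> {v \<in> S. u < v}) = F (h u) {v \<in> S. v < u} \<^bold>* F (h u) {v \<in> S. u < v}"
      using assms by (intro union_disjoint) auto
    finally show ?thesis .
  qed
  then have "F (\<lambda>u. F (h u) S) S
    = F (\<lambda>u. h u u) S \<^bold>* (F (\<lambda>u. F (h u) {v \<in> S. v < u}) S \<^bold>* F (\<lambda>u. F (h u) {v \<in> S. u < v}) S)"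
    by (simp add: distrib cong: cong)
  also have "F (\<lambda>u. F (h u) {v \<in> S. u < v}) S = F (\<lambda>u. F (\<lambda>v. h v u) {v \<in> S. v < u}) S"
    using assms by (rule swap_restrict[OF assms])
  also have "F (\<lambda>u. F (h u) {v \<in> S. v < u}) S \<^bold>* F (\<lambda>u. F (\<lambda>v. h v u) {v \<in> S. v < u}) S
      = F (\<lambda>u. F (\<lambda>v. h u v \<^bold>* h v u) {v \<in> S. v < u}) S"
    by (simp add: distrib)
  finally show ?thesis .
qed

end

section \<open>Evaluation of the hook product and the hook count\<close>

context odd_modulus
begin

lemma multiples_eq:
  assumes "a \<le> u"
  shows "{y \<in> {a..<u}. t dvd u - y} = (\<lambda>k. u - t * int k) ` {1..quo (u - a)}"
proof (intro equalityI subsetI)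
  fix y assume y: "y \<in> {y \<in> {a..<u}. t dvd u - y}"
  then obtain k where k: "u - y = t * k" by blast
  have "0 < t * k" using y k[symmetric] by simp
  then have "0 < k" using t_pos by (simp add: zero_less_mult_iff)
  have "t * k \<le> u - a" using y k by simp
  then have "(t * k) div t \<le> (u - a) div t" using t_pos by (rule zdiv_mono1)
  then have "nat k \<in> {1..quo (u - a)}" using \<open>0 < k\<close> t_pos by (simp add: quo_def le_nat_iff nat_mono)
  moreover have "y = u - t * int (nat k)" using k \<open>0 < k\<close> by simp
  ultimately show "y \<in> (\<lambda>k. u - t * int k) ` {1..quo (u - a)}" by blast
next
  fix y assume "y \<in> (\<lambda>k. u - t * int k) ` {1..quo (u - a)}"
  then obtain k where k: "1 \<le> k" "k \<le> quo (u - a)" "y = u - t * int k" by auto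
  have "t * int k \<le> t * int (quo (u - a))" using k t_pos by simp
  also have "\<dots> \<le> u - a"
    using quo_decomp[of "u - a"] pos_mod_sign[OF t_pos, of "u - a"] assms by linarith
  finally show "y \<in> {y \<in> {a..<u}. t dvd u - y}" using k t_pos by simp
qed

lemma inj_multiples: "inj_on (\<lambda>k. u - t * int k) A"
  using t_pos by (auto simp: inj_on_def)

lemma multiples_split:
  assumes "\<And>v. v \<in> S \<Longrightarrow> a \<le> v"
  shows "{y \<in> {a..<u}. t dvd u - y} = {y \<in> {a..<u} - S. t dvd u - y} \<union> {v \<in> S. v < u \<and> t dvd u - v}"
  using assms by auto

text \<open>The product over all multiples, a power of \<open>t\<close> times a factorial, divided
  by the factors at elements of \<open>S\<close>: this is the origin of the numerators in
  \<open>wt2\<close>. The constant \<open>c\<close> carries the hook sign.\<close>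

lemma prod_multiples:
  fixes c :: real
  assumes S: "finite S" "\<And>v. v \<in> S \<Longrightarrow> a \<le> v" and "a \<le> u" "c \<noteq> 0"
  shows "(\<Prod>y\<in>{y \<in> {a..<u} - S. t dvd u - y}. c / of_int (u - y))
     = c ^ quo (u - a) / (of_int t ^ quo (u - a) * fact (quo (u - a)))
       * (\<Prod>v\<in>{v \<in> S. v < u}. if t dvd u - v then of_int (u - v) / c else 1)"
proof -
  let ?P = "\<lambda>A. \<Prod>y\<in>A. c / real_of_int (u - y)"
  have e1: "?P {y \<in> {a..<u}. t dvd u - y} = ?P {y \<in> {a..<u} - S. t dvd u - y} * ?P {v \<in> S. v < u \<and> t dvd u - v}"
  proof -
    have un: "{y \<in> {a..<u}. t dvd u - y} = {y \<in> {a..<u} - S. t dvd u - y} \<union> {v \<in> S. v < u \<and> t dvd u - v}"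
      by (rule multiples_split) (rule S(2))
    have "finite {y \<in> {a..<u} - S. t dvd u - y}" by (rule finite_subset[of _ "{a..<u}"]) auto
    then show ?thesis unfolding un using S(1) by (intro prod.union_disjoint) auto
  qed
  have e2: "?P {y \<in> {a..<u}. t dvd u - y} = c ^ quo (u - a) / (of_int t ^ quo (u - a) * fact (quo (u - a)))"
    unfolding multiples_eq[OF assms(3)]
    by (simp add: prod.reindex inj_multiples card_image prod_dividef prod.distrib fact_prod)
  have e3: "?P {v \<in> S. v < u \<and> t dvd u - v} * (\<Prod>v\<in>{v \<in> S. v < u}. if t dvd u - v then of_int (u - v) / c else 1) = 1"
  proof -
    have eq: "{v \<in> S. v < u \<and> t dvd u - v} = {v \<in> {v \<in> S. v < u}. t dvd u - v}" by auto
    have "?P {v \<in> S. v < u \<and> t dvd u - v} = (\<Prod>v\<in>{v \<in> S. v < u}. if t dvd u - v then c / of_int (u - v) else 1)"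
      unfolding eq by (rule prod.inter_filter) (use S(1) in simp)
    also have "\<dots> * (\<Prod>v\<in>{v \<in> S. v < u}. if t dvd u - v then of_int (u - v) / c else 1) = 1"
      unfolding prod.distrib[symmetric] using assms(4) by (intro prod.neutral) auto
    finally show ?thesis .
  qed
  have "d = e * g" if "b = d * h" "b = e" "h * g = 1" for b d e g h :: real
  proof -
    have "e * g = d * (h * g)" unfolding that(2)[symmetric] that(1) by (rule mult.assoc)
    then show ?thesis unfolding that(3) by simp
  qed
  from this[OF e1 e2 e3] show ?thesis .
qed

lemma card_multiples:
  assumes S: "finite S" "\<And>v. v \<in> S \<Longrightarrow> a \<le> v" and "a \<le> u"
  shows "int (card {y \<in> {a..<u} - S. t dvd u - y})
     = int (quo (u - a)) - (\<Sum>v\<in>{v \<in> S. v < u}. of_bool (t dvd u - v))"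
proof -
  have "card {y \<in> {a..<u}. t dvd u - y} = card {y \<in> {a..<u} - S. t dvd u - y} + card {v \<in> S. v < u \<and> t dvd u - v}"
  proof -
    have un: "{y \<in> {a..<u}. t dvd u - y} = {y \<in> {a..<u} - S. t dvd u - y} \<union> {v \<in> S. v < u \<and> t dvd u - v}"
      by (rule multiples_split) (rule S(2))
    have "finite {y \<in> {a..<u} - S. t dvd u - y}" by (rule finite_subset[of _ "{a..<u}"]) auto
    then show ?thesis unfolding un using S(1) by (intro card_Un_disjoint) auto
  qed
  moreover have "card {y \<in> {a..<u}. t dvd u - y} = quo (u - a)"
    unfolding multiples_eq[OF assms(3)] by (simp add: card_image inj_multiples)
  moreover have "int (card {v \<in> S. v < u \<and> t dvd u - v}) = (\<Sum>v\<in>{v \<in> S. v < u}. of_bool (t dvd u - v))"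
  proof -
    have "{v \<in> S. v < u \<and> t dvd u - v} = {v \<in> S. v < u} \<inter> {v. t dvd u - v}" by auto
    then show ?thesis using S(1) by (simp add: sum_of_bool_eq)
  qed
  ultimately show ?thesis by simp
qed

text \<open>Oddness again: the hook length \<open>2 * u\<close> counts exactly when \<open>t\<close>
  divides \<open>u\<close>.\<close>

lemma dvd_double: "t dvd 2 * u \<longleftrightarrow> t dvd u"
proof -
  have "coprime t 2" using odd_t by simp
  then show ?thesis by (rule coprime_dvd_mult_right_iff)
qed

lemma quo_pred:
  assumes "0 < u"
  shows "quo (u - 1) = (if t dvd u then quo u - 1 else quo u)"
proof (cases "t dvd u")
  case True
  then have u: "u = t * int (quo u)" using quo_decomp[of u] assms by simp
  then have "0 < quo u" using assms by (auto intro!: Nat.gr0I)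
  then obtain k where k: "quo u = Suc k" using gr0_conv_Suc by blast
  then have "u - 1 = t * int k + (t - 1)" using u by (simp add: algebra_simps)
  then have "quo (u - 1) = k" using t_pos by (intro quo_eqI[of _ _ "t - 1"]) auto
  then show ?thesis using True k by simp
next
  case False
  then have "0 < u mod t" using pos_mod_sign[OF t_pos, of u] by (simp add: dvd_eq_mod_eq_0)
  then show ?thesis using False quo_decomp[of u] assms pos_mod_bound[OF t_pos, of u]
      quo_eqI[of "u - 1" "quo u" "u mod t - 1"] by simp
qed

lemma quo_pos: "0 < u \<Longrightarrow> t dvd u \<Longrightarrow> 0 < quo u"
  using quo_decomp[of u] by (auto intro!: Nat.gr0I)

lemma wt_eq:
  assumes "0 < u"
  shows "- (1 / (of_int t ^ quo u * fact (quo u))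
     * ((-1) ^ quo (u - 1) / (of_int t ^ quo (u - 1) * fact (quo (u - 1))))
     * (if t dvd u then 1 / (of_int u + of_int u) else 1)) = wt u"
proof (cases "t dvd u")
  case True
  then obtain k where k: "quo u = Suc k" using quo_pos assms gr0_conv_Suc by blast
  then have "quo (u - 1) = k" using True assms by (simp add: quo_pred)
  moreover have "u = t * int (Suc k)" using quo_decomp[of u] True assms k by simp
  then have "real_of_int u = of_int t * (real k + 1)" by simp
  moreover have "- (1 / (T * P * (m * f)) * (s / (P * f)) * (1 / (T * m + T * m))) = - s / ((T * P)\<^sup>2 * (m * f)\<^sup>2) * (1 / 2)"
    if "T \<noteq> 0" "P \<noteq> 0" "m \<noteq> 0" "f \<noteq> 0" for T P m f s :: real
    using that by (simp add: power2_eq_square)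
  from this[of "of_int t" "of_int t ^ k" "real k + 1" "fact k" "(-1) ^ k"]
  have "- (1 / (of_int t ^ Suc k * fact (Suc k)) * ((-1) ^ k / (of_int t ^ k * fact k))
      * (1 / (of_int t * (real k + 1) + of_int t * (real k + 1))))
    = (-1) ^ Suc k / (of_int t ^ (2 * Suc k) * (fact (Suc k))\<^sup>2) * (1 / 2 :: real)"
    using t_pos by (simp only: power_Suc fact_Suc power_even_eq) (simp add: add.commute)
  ultimately show ?thesis using True k by (simp only: wt_def if_True)
next
  case False
  then show ?thesis using assms by (simp add: wt_def quo_pred power2_eq_square mult_2 power_add)
qed

text \<open>The first and third families of \<open>hook_pairs_Un\<close> are runs of multiples, the
  second consists of the sums. Regrouping by single elements and by pairs gives \<open>wt\<close>
  and \<open>wt2\<close>; the power of -1 becomes \<open>delta\<close>.\<close>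

lemma prod_hook_pairs:
  assumes S: "finite S" "\<And>u. u \<in> S \<Longrightarrow> 0 < u"
  shows "(-1) ^ card S * (\<Prod>(x, y)\<in>hook_pairs t S. 1 / (of_int (x - y) * (if x + y < 0 then -1 else 1))) = total_wt S"
proof -
  define w :: "int \<Rightarrow> int \<Rightarrow> real" where "w x y = 1 / (of_int (x - y) * (if x + y < 0 then -1 else 1))" for x y
  have low: "0 \<le> v" "1 \<le> v" if "v \<in> S" for v using S(2)[OF that] by auto
  have A: "(\<Prod>y\<in>{y \<in> {0..<u} - S. t dvd u - y}. w u y)
     = 1 / (of_int t ^ quo u * fact (quo u)) * (\<Prod>v\<in>{v \<in> S. v < u}. if t dvd u - v then of_int (u - v) else 1)"
    if u: "u \<in> S" for u
  proof -
    have "(\<Prod>y\<in>{y \<in> {0..<u} - S. t dvd u - y}. w u y) = (\<Prod>y\<in>{y \<in> {0..<u} - S. t dvd u - y}. 1 / of_int (u - y))"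
      using S(2)[OF u] by (intro prod.cong) (auto simp: w_def)
    then show ?thesis using prod_multiples[OF S(1) low(1), of u 1] S(2)[OF u] by (simp cong: if_cong)
  qed
  have C: "(\<Prod>m\<in>{m \<in> {1..<u} - S. t dvd u - m}. w (- m) (- u))
     = (-1) ^ quo (u - 1) / (of_int t ^ quo (u - 1) * fact (quo (u - 1)))
       * (\<Prod>v\<in>{v \<in> S. v < u}. if t dvd u - v then - of_int (u - v) else 1)"
    if u: "u \<in> S" for u
  proof -
    have "(\<Prod>m\<in>{m \<in> {1..<u} - S. t dvd u - m}. w (- m) (- u)) = (\<Prod>m\<in>{m \<in> {1..<u} - S. t dvd u - m}. (-1) / of_int (u - m))"
      using S(2)[OF u] by (intro prod.cong) (auto simp: w_def minus_divide_right)
    then show ?thesis using prod_multiples[OF S(1) low(2), of u "-1"] S(2)[OF u] by (simp cong: if_cong)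
  qed
  have B: "(\<Prod>u\<in>S. \<Prod>v\<in>{v \<in> S. t dvd u + v}. w u (- v))
     = (\<Prod>u\<in>S. if t dvd u then 1 / (of_int u + of_int u) else 1)
       * (\<Prod>u\<in>S. \<Prod>v\<in>{v \<in> S. v < u}. if t dvd u + v then - (1 / (of_int (u + v))\<^sup>2) else 1)"
  proof -
    have "(\<Prod>u\<in>S. \<Prod>v\<in>{v \<in> S. t dvd u + v}. w u (- v)) = (\<Prod>u\<in>S. \<Prod>v\<in>S. if t dvd u + v then w u (- v) else 1)"
      using S(1) by (simp add: prod.inter_filter)
    also have "\<dots> = (\<Prod>u\<in>S. if t dvd u + u then w u (- u) else 1)
        * (\<Prod>u\<in>S. \<Prod>v\<in>{v \<in> S. v < u}. (if t dvd u + v then w u (- v) else 1) * (if t dvd v + u then w v (- u) else 1))"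
      by (rule prod.square_decomp[OF S(1)])
    also have "(\<Prod>u\<in>S. if t dvd u + u then w u (- u) else 1) = (\<Prod>u\<in>S. if t dvd u then 1 / (of_int u + of_int u) else 1)"
      by (intro prod.cong) (auto simp: dvd_double w_def)
    \<comment> \<open>Of the two hook pairs \<open>(u, - v)\<close> and \<open>(v, - u)\<close> with
      \<open>v < u\<close>, the second has negative edge sum and hence the sign -1.\<close>
    also have "(\<Prod>u\<in>S. \<Prod>v\<in>{v \<in> S. v < u}. (if t dvd u + v then w u (- v) else 1) * (if t dvd v + u then w v (- u) else 1))
      = (\<Prod>u\<in>S. \<Prod>v\<in>{v \<in> S. v < u}. if t dvd u + v then - (1 / (of_int (u + v))\<^sup>2) else 1)"
    proof (intro prod.cong refl)
      fix u v assume "u \<in> S" "v \<in> {v \<in> S. v < u}"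
      then have "w u (- v) = 1 / of_int (u + v)" "w v (- u) = - (1 / of_int (u + v))"
        by (simp_all add: w_def minus_divide_right algebra_simps)
      then show "(if t dvd u + v then w u (- v) else 1) * (if t dvd v + u then w v (- u) else 1)
          = (if t dvd u + v then - (1 / (of_int (u + v))\<^sup>2) else 1)"
        by (simp add: add.commute power2_eq_square)
    qed
    finally show ?thesis .
  qed
  have decomp: "(\<Prod>(x, y)\<in>hook_pairs t S. w x y)
    = (\<Prod>u\<in>S. \<Prod>y\<in>{y \<in> {0..<u} - S. t dvd u - y}. w u y) *
      ((\<Prod>u\<in>S. \<Prod>v\<in>{v \<in> S. t dvd u + v}. w u (- v)) *
       (\<Prod>v\<in>S. \<Prod>m\<in>{m \<in> {1..<v} - S. t dvd v - m}. w (- m) (- v)))"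
    by (rule prod.hook_pairs_decomp[OF S(1)]) (rule S(2))
  have "(\<Prod>(x, y)\<in>hook_pairs t S. w x y)
     = (\<Prod>u\<in>S. 1 / (of_int t ^ quo u * fact (quo u)) * ((-1) ^ quo (u - 1) / (of_int t ^ quo (u - 1) * fact (quo (u - 1))))
          * (if t dvd u then 1 / (of_int u + of_int u) else 1))
       * (\<Prod>u\<in>S. \<Prod>v\<in>{v \<in> S. v < u}. wt2 u v)"
  proof -
    have "wt2 u v = (if t dvd u - v then of_int (u - v) else 1) * ((if t dvd u - v then - of_int (u - v) else 1)
        * (if t dvd u + v then - (1 / (of_int (u + v))\<^sup>2) else 1))" for u v
      by (simp add: wt2_def power2_eq_square del: minus_diff_eq of_int_diff)
    note wt2 = this
    have A': "(\<Prod>u\<in>S. \<Prod>y\<in>{y \<in> {0..<u} - S. t dvd u - y}. w u y) = (\<Prod>u\<in>S. 1 / (of_int t ^ quo u * fact (quo u))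
        * (\<Prod>v\<in>{v \<in> S. v < u}. if t dvd u - v then of_int (u - v) else 1))"
      by (rule prod.cong[OF refl A])
    have C': "(\<Prod>u\<in>S. \<Prod>m\<in>{m \<in> {1..<u} - S. t dvd u - m}. w (- m) (- u))
       = (\<Prod>u\<in>S. (-1) ^ quo (u - 1) / (of_int t ^ quo (u - 1) * fact (quo (u - 1)))
         * (\<Prod>v\<in>{v \<in> S. v < u}. if t dvd u - v then - of_int (u - v) else 1))"
      by (rule prod.cong[OF refl C])
    show ?thesis
      unfolding decomp A' B C' wt2 prod.distrib by (simp only: mult_ac)
  qed
  moreover have "(-1) ^ card S * (\<Prod>u\<in>S. 1 / (of_int t ^ quo u * fact (quo u)) * ((-1) ^ quo (u - 1) / (of_int t ^ quo (u - 1) * fact (quo (u - 1))))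
          * (if t dvd u then 1 / (of_int u + of_int u) else 1)) = (\<Prod>u\<in>S. wt u)"
    unfolding prod_uminus[symmetric] by (rule prod.cong[OF refl wt_eq[OF S(2)]])
  ultimately show ?thesis unfolding total_wt_def w_def by (simp add: mult.assoc)
qed

lemma card_hook_pairs:
  assumes S: "finite S" "\<And>u. u \<in> S \<Longrightarrow> 0 < u"
  shows "int (card (hook_pairs t S)) = 2 * hooks S"
proof -
  have low: "0 \<le> v" "1 \<le> v" if "v \<in> S" for v using S(2)[OF that] by auto
  have B: "(\<Sum>u\<in>S. \<Sum>v\<in>{v \<in> S. t dvd u + v}. 1)
     = (\<Sum>u\<in>S. of_bool (t dvd u)) + (\<Sum>u\<in>S. \<Sum>v\<in>{v \<in> S. v < u}. 2 * of_bool (t dvd u + v) :: int)"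
  proof -
    have "(\<Sum>u\<in>S. \<Sum>v\<in>{v \<in> S. t dvd u + v}. 1) = (\<Sum>u\<in>S. \<Sum>v\<in>S. of_bool (t dvd u + v) :: int)"
      using S(1) by (simp add: of_bool_def sum.inter_filter[symmetric])
    also have "\<dots> = (\<Sum>u\<in>S. of_bool (t dvd u + u))
        + (\<Sum>u\<in>S. \<Sum>v\<in>{v \<in> S. v < u}. of_bool (t dvd u + v) + of_bool (t dvd v + u))"
      by (rule sum.square_decomp[OF S(1)])
    finally show ?thesis by (simp add: dvd_double add.commute)
  qed
  \<comment> \<open>The second run is one shorter when \<open>t\<close> divides \<open>u\<close>,
    and the hook length \<open>2 * u\<close> makes up for it.\<close>
  have q: "int (quo u) + int (quo (u - 1)) + of_bool (t dvd u) = 2 * int (quo u)" if "u \<in> S" for u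
    using quo_pos[OF S(2)[OF that]]
    by (cases "t dvd u") (simp_all add: quo_pred[OF S(2)[OF that]] of_nat_diff Suc_le_eq)
  have "int (card (hook_pairs t S)) = (\<Sum>(x, y)\<in>hook_pairs t S. 1)"
    by (simp add: case_prod_unfold)
  also have "\<dots> = (\<Sum>u\<in>S. int (card {y \<in> {0..<u} - S. t dvd u - y}))
     + ((\<Sum>u\<in>S. \<Sum>v\<in>{v \<in> S. t dvd u + v}. 1) + (\<Sum>v\<in>S. int (card {m \<in> {1..<v} - S. t dvd v - m})))"
    by (subst sum.hook_pairs_decomp[OF S]) simp_all
  also have "(\<Sum>u\<in>S. int (card {y \<in> {0..<u} - S. t dvd u - y}))
    = (\<Sum>u\<in>S. int (quo u) - (\<Sum>v\<in>{v \<in> S. v < u}. of_bool (t dvd u - v)))"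
    using card_multiples[OF S(1) low(1)] low by (intro sum.cong) auto
  also have "(\<Sum>u\<in>S. int (card {m \<in> {1..<u} - S. t dvd u - m}))
    = (\<Sum>u\<in>S. int (quo (u - 1)) - (\<Sum>v\<in>{v \<in> S. v < u}. of_bool (t dvd u - v)))"
    using card_multiples[OF S(1) low(2)] low by (intro sum.cong) auto
  finally have "int (card (hook_pairs t S)) = (\<Sum>u\<in>S. int (quo u) + int (quo (u - 1)) + of_bool (t dvd u))
     + 2 * (\<Sum>u\<in>S. \<Sum>v\<in>{v \<in> S. v < u}. cnt u v)"
    unfolding B cnt_def by (simp add: sum.distrib sum_subtractf sum_distrib_left[symmetric])
  also have "(\<Sum>u\<in>S. int (quo u) + int (quo (u - 1)) + of_bool (t dvd u)) = 2 * (\<Sum>u\<in>S. int (quo u))"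
    unfolding sum_distrib_left by (rule sum.cong[OF refl q])
  finally show ?thesis by (simp add: hooks_def)
qed

end

section \<open>Return from sets to partitions\<close>

context
  fixes la :: "nat list"
  assumes la: "la \<in> DD"
begin

lemma frob_pos: "u \<in> frob la \<Longrightarrow> 0 < u"
  by (simp add: frob_def)

lemma bij_hook_pairs:
  "bij_betw (\<lambda>(i, j). (row la i, col la j)) (hook_boxes t la) (hook_pairs (int t) (frob la))"
  using bij_hook_boxes[of la t] la maya_DD[OF la] by (simp add: DD_def hook_pairs_def)

text \<open>The case \<open>t = 1\<close> of the hook count: all boxes are counted,
  \<open>quo\<close> is the identity on positive integers, and \<open>cnt\<close> vanishes.\<close>

lemma weight_DD: "int (weight la) = 2 * \<Sum>(frob la)"
proof -
  interpret one: odd_modulus 1 by standard auto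
  have p: "is_partition la" using la by (simp add: DD_def)
  have "hook_boxes 1 la = boxes la" by (auto simp: hook_boxes_def)
  then have "weight la = card (hook_pairs 1 (frob la))"
    using card_boxes[OF p] bij_betw_same_card[OF bij_hook_pairs[of 1]] by simp
  then have "int (weight la) = 2 * one.hooks (frob la)"
    using one.card_hook_pairs[OF finite_frob[OF la] frob_pos] by simp
  also have "one.hooks (frob la) = \<Sum>(frob la)"
    unfolding one.hooks_def one.cnt_def one.quo_def
    using frob_pos by (auto intro!: sum.cong simp: less_imp_le)
  finally show ?thesis .
qed

lemma size_hook_multiset:
  assumes "odd t"
  shows "int (size (hook_multiset t la)) = 2 * odd_modulus.hooks (int t) (frob la)"
proof -
  interpret odd_modulus "int t" using assms by unfold_locales (auto intro!: Nat.gr0I)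
  have "size (hook_multiset t la) = card (hook_pairs (int t) (frob la))"
    using bij_betw_same_card[OF bij_hook_pairs[of t]] by (simp add: hook_multiset_def)
  then show ?thesis using card_hook_pairs[OF finite_frob[OF la] frob_pos] by simp
qed

lemma summand_DD:
  assumes "odd t"
  shows "of_int (delta la) * (\<Prod>b\<in>hook_boxes t la. 1 / (of_nat (hook_length la b) * of_int (hook_sign b)))
     = odd_modulus.total_wt (int t) (frob la)"
proof -
  interpret odd_modulus "int t" using assms by unfold_locales (auto intro!: Nat.gr0I)
  have p: "is_partition la" using la by (simp add: DD_def)
  let ?g = "\<lambda>(x, y). 1 / (real_of_int (x - y) * (if x + y < 0 then -1 else 1))"
  have "(\<Prod>b\<in>hook_boxes t la. 1 / (of_nat (hook_length la b) * of_int (hook_sign b)))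
      = (\<Prod>b\<in>hook_boxes t la. ?g (case b of (i, j) \<Rightarrow> (row la i, col la j)))"
  proof (rule prod.cong[OF refl])
    fix b assume b: "b \<in> hook_boxes t la"
    obtain i j where ij: "b = (i, j)" by fastforce
    then have box: "(i, j) \<in> boxes la" using b by (simp add: hook_boxes_def)
    have "real (hook_length la (i, j)) = of_int (row la i - col la j)"
      using arg_cong[OF hook_length_eq[OF p box], of real_of_int] by simp
    then show "1 / (of_nat (hook_length la b) * of_int (hook_sign b))
        = ?g (case b of (i, j) \<Rightarrow> (row la i, col la j))"
      using ij hook_sign_DD[OF la box] by simp
  qed
  also have "\<dots> = prod ?g (hook_pairs (int t) (frob la))"
    by (rule prod.reindex_bij_betw[OF bij_hook_pairs])
  finally show ?thesis
    using prod_hook_pairs[OF finite_frob[OF la] frob_pos] card_frob[OF la] by (simp add: delta_def)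
qed

end

theorem corollary4p11:
  fixes t n :: nat
  assumes "odd t"
  shows "(\<Sum>la \<in> {la \<in> DD. weight la = 2 * t * n \<and> size (hook_multiset t la) = 2 * n}.
            of_int (delta la) *
            (\<Prod>b \<in> hook_boxes t la. 1 / (of_nat (hook_length la b) * of_int (hook_sign b))))
         = ((-1) ^ n / (fact n * of_nat t ^ n * 2 ^ n) :: real)"
proof -
  interpret odd_modulus "int t" using assms by unfold_locales (auto intro!: Nat.gr0I)
  let ?L = "{la \<in> DD. weight la = 2 * t * n \<and> size (hook_multiset t la) = 2 * n}"
  \<comment> \<open>\<open>weight_DD\<close> and \<open>size_hook_multiset\<close> both carry a
    factor 2, which reduces 2 t n and 2 n to the t n and n of \<open>states\<close>.\<close>
  have iff: "la \<in> ?L \<longleftrightarrow> frob la \<in> states n" if la: "la \<in> DD" for la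
  proof -
    have "weight la = 2 * t * n \<longleftrightarrow> int (weight la) = 2 * (int t * int n)"
      by (metis (mono_tags, opaque_lifting) mult.assoc of_nat_eq_iff of_nat_mult of_nat_numeral)
    moreover have "size (hook_multiset t la) = 2 * n \<longleftrightarrow> int (size (hook_multiset t la)) = 2 * int n"
      by linarith
    ultimately show ?thesis
      using la finite_frob[OF la] frob_pos[OF la] weight_DD[OF la] size_hook_multiset[OF la assms]
      by (auto simp: states_def)
  qed
  have "frob ` ?L = states n"
  proof (intro equalityI subsetI)
    fix S assume S: "S \<in> states n"
    then obtain la where "la \<in> DD" "frob la = S"
      using frob_surj[of S] by (auto simp: states_def)
    then show "S \<in> frob ` ?L" using S iff[of la] by blast
  qed (use iff in auto)
  moreover have "inj_on frob ?L" using inj_frob by (rule inj_on_subset) auto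
  ultimately have bij: "bij_betw frob ?L (states n)" by (simp add: bij_betw_def)
  have "(\<Sum>la\<in>?L. of_int (delta la) *
            (\<Prod>b \<in> hook_boxes t la. 1 / (of_nat (hook_length la b) * of_int (hook_sign b))))
      = (\<Sum>la\<in>?L. total_wt (frob la))"
    using summand_DD[OF _ assms] by (intro sum.cong) auto
  also have "\<dots> = (\<Sum>S\<in>states n. total_wt S)" by (rule sum.reindex_bij_betw[OF bij])
  also have "\<dots> = (-1) ^ n / (fact n * of_nat t ^ n * 2 ^ n)" by (simp add: total_states)
  finally show ?thesis .
qed

end
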